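(* Let $\rho>\max\{0,-\alpha\}$, $0<\gamma<\sigma\le 1$, $U(\infty)=V(\infty)=\infty$, $0<p<1$, $\frac1p+\frac1q=1$ (so $q<0$). For all measurable $f\ge 0$ on $\mathbf{R}_+$ and all sequences $a_n\ge 0$ ($n\in\mathbf{N}$) with $0<\|f\|_{p,\Phi_\delta}<\infty$ and $0<\|a\|_{q,\Psi_\beta}<\infty$, the following equivalent inequalities hold: $$\sum_{n=1}^\infty\int_0^\infty K_\delta(x,n)\,a_n f(x)\,dx>k(\sigma)\,\|f\|_{p,\widetilde\Phi_\delta}\|a\|_{q,\Psi_\beta},$$ $$\left\{\sum_{n=1}^\infty\frac{\nu_{n+1}}{(V_n-\beta)^{1-p\sigma}}\left[\int_0^\infty K_\delta(x,n)f(x)\,dx\right]^p\right\}^{1/p}>k(\sigma)\,\|f\|_{p,\widetilde\Phi_\delta},$$ $$\left\{\int_0^\infty\frac{(1-\theta_\delta(\sigma,x))^{1-q}\mu(x)}{U^{1-q\delta\sigma}(x)}\left[\sum_{n=1}^\infty K_\delta(x,n)a_n\right]^q dx\right\}^{1/q}>k(\sigma)\,\|a\|_{q,\Psi_\beta}.$$ Moreover the constant factor $k(\sigma)$ is the best possible in each of them: for the given parameters, $\mu$ and $\{\nu_n\}$, in none of these inequalities can the factor $k(\sigma)$ on the right-hand side be replaced by a larger constant so that the inequality remains valid for all such $f$ and $a$.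
   Context: Setting. $\mathbf{R}_+=(0,\infty)$, $\mathbf{N}=\{1,2,\dots\}$, and $\alpha,\rho,\gamma,\sigma,\beta$ are real. $\{\nu_n\}_{n\ge1}$ is a decreasing (i.e. $\nu_{n+1}\le\nu_n$) sequence of positive reals, $V_n=\sum_{j=1}^n\nu_j$, $V(\infty)=\sum_{j=1}^\infty\nu_j$, and $\beta\le\nu_1/2$. $\mu$ is a positive continuous function on $\mathbf{R}_+$ with $U(x):=\int_0^x\mu(t)\,dt<\infty$ for all $x>0$, and $U(\infty)=\lim_{x\to\infty}U(x)$. $\delta\in\{-1,1\}$ is fixed. Powers such as $U^{s}(x)$ mean $(U(x))^{s}$. Kernel: with $\operatorname{csch}(u)=\frac{2}{e^u-e^{-u}}$ ($u>0$), $$K_\delta(x,n):=\frac{\operatorname{csch}\big(\rho\,U^{\delta\gamma}(x)(V_n-\beta)^\gamma\big)}{e^{\alpha U^{\delta\gamma}(x)(V_n-\beta)^\gamma}}.$$ Constant: $$k(\sigma):=\int_0^\infty\frac{\operatorname{csch}(\rho t^\gamma)}{e^{\alpha t^\gamma}}t^{\sigma-1}dt=\frac{2\Gamma(\sigma/\gamma)}{\gamma(2\rho)^{\sigma/\gamma}}\,\zeta\!\left(\frac{\sigma}{\gamma},\frac{\alpha+\rho}{2\rho}\right),$$ where $\zeta(s,a)=\sum_{k=0}^\infty (k+a)^{-s}$ ($s>1$, $a>0$) is the Hurwitz zeta function. Also $$\theta_\delta(\sigma,x):=\frac1{k(\sigma)}\int_0^{U^\delta(x)(\nu_1-\beta)}\frac{\operatorname{csch}(\rho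 u^\gamma)}{e^{\alpha u^\gamma}}u^{\sigma-1}du\in(0,1).$$ Formal norms: $\Phi_\delta(x):=\frac{U^{p(1-\delta\sigma)-1}(x)}{\mu^{p-1}(x)}$, $\widetilde\Phi_\delta(x):=(1-\theta_\delta(\sigma,x))\Phi_\delta(x)$, $\Psi_\beta(n):=\frac{(V_n-\beta)^{q(1-\sigma)-1}}{\nu_{n+1}^{q-1}}$; for a weight $w$, $\|f\|_{p,w}=\left(\int_0^\infty w(x)f^p(x)\,dx\right)^{1/p}$, and $\|a\|_{q,\Psi_\beta}=\left(\sum_{n=1}^\infty\Psi_\beta(n)a_n^q\right)^{1/q}$. All quantities take values in $[0,\infty]$, with the usual conventions $0^r=+\infty$ and $(+\infty)^r=0$ for $r<0$. *)

theory Defs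
  imports "HOL-Analysis.Analysis"
begin

text \<open>
  Sequences indexed by the positive integers are functions on \<^typ>\<open>nat\<close> whose value at \<open>0\<close> is
  never used; a sum over the positive integers is \<open>\<Sum>n. g (Suc n)\<close>, taken in \<^typ>\<open>ennreal\<close>.
  Likewise functions on the open half-line are functions on \<^typ>\<open>real\<close> that are only
  inspected on \<open>{0<..}\<close>.
\<close>

text \<open>
  Real powers on \<open>[0, \<infinity>]\<close>, with the conventions \<open>0\<close> to a negative power is \<open>\<infinity>\<close>, and \<open>\<infinity>\<close> to a
  negative power is \<open>0\<close>.  (By contrast, \<open>powr\<close> on the reals has \<open>0 powr r = 0\<close>; below it is
  only applied to bases that are positive in the intended setting.)
\<close>

definition epowr :: "ennreal \<Rightarrow> real \<Rightarrow> ennreal" where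
  "epowr x r =
    (if r = 0 then 1
     else if x = 0 then (if r < 0 then \<infinity> else 0)
     else if x = \<infinity> then (if r < 0 then 0 else \<infinity>)
     else ennreal (enn2real x powr r))"

definition csch :: "real \<Rightarrow> real" where
  "csch u = 2 / (exp u - exp (- u))"

definition U :: "(real \<Rightarrow> real) \<Rightarrow> real \<Rightarrow> real" where
  "U \<mu> x = (LINT t:{0<..x}|lborel. \<mu> t)"

definition V :: "(nat \<Rightarrow> real) \<Rightarrow> nat \<Rightarrow> real" where
  "V \<nu> n = (\<Sum>j=1..n. \<nu> j)"

definition kernel ::
  "real \<Rightarrow> real \<Rightarrow> real \<Rightarrow> real \<Rightarrow> real \<Rightarrow> (real \<Rightarrow> real) \<Rightarrow> (nat \<Rightarrow> real) \<Rightarrow> real \<Rightarrow> nat \<Rightarrow> real" where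
  "kernel \<alpha> \<rho> \<gamma> \<beta> \<delta> \<mu> \<nu> x n =
     csch (\<rho> * U \<mu> x powr (\<delta> * \<gamma>) * (V \<nu> n - \<beta>) powr \<gamma>)
     / exp (\<alpha> * U \<mu> x powr (\<delta> * \<gamma>) * (V \<nu> n - \<beta>) powr \<gamma>)"

text \<open>
  The integral converges whenever \<open>\<rho> > max 0 (-\<alpha>)\<close> and \<open>0 < \<gamma> < \<sigma>\<close>, so the Bochner integral has
  its usual meaning there, both in \<open>k_const\<close> and in \<open>theta\<close>.
\<close>

definition k_const :: "real \<Rightarrow> real \<Rightarrow> real \<Rightarrow> real \<Rightarrow> real" where
  "k_const \<alpha> \<rho> \<gamma> \<sigma> =
     (LINT t:{0<..}|lborel. csch (\<rho> * t powr \<gamma>) / exp (\<alpha> * t powr \<gamma>) * t powr (\<sigma> - 1))"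

definition theta ::
  "real \<Rightarrow> real \<Rightarrow> real \<Rightarrow> real \<Rightarrow> real \<Rightarrow> real \<Rightarrow> (real \<Rightarrow> real) \<Rightarrow> (nat \<Rightarrow> real) \<Rightarrow> real \<Rightarrow> real" where
  "theta \<alpha> \<rho> \<gamma> \<sigma> \<beta> \<delta> \<mu> \<nu> x =
     1 / k_const \<alpha> \<rho> \<gamma> \<sigma> *
     (LINT u:{0<..U \<mu> x powr \<delta> * (\<nu> 1 - \<beta>)}|lborel.
        csch (\<rho> * u powr \<gamma>) / exp (\<alpha> * u powr \<gamma>) * u powr (\<sigma> - 1))"

definition Phi :: "real \<Rightarrow> real \<Rightarrow> real \<Rightarrow> (real \<Rightarrow> real) \<Rightarrow> real \<Rightarrow> real" where
  "Phi p \<sigma> \<delta> \<mu> x = U \<mu> x powr (p * (1 - \<delta> * \<sigma>) - 1) / \<mu> x powr (p - 1)"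

definition Phi_tilde ::
  "real \<Rightarrow> real \<Rightarrow> real \<Rightarrow> real \<Rightarrow> real \<Rightarrow> real \<Rightarrow> real \<Rightarrow> (real \<Rightarrow> real) \<Rightarrow> (nat \<Rightarrow> real) \<Rightarrow> real \<Rightarrow> real" where
  "Phi_tilde p \<alpha> \<rho> \<gamma> \<sigma> \<beta> \<delta> \<mu> \<nu> x = (1 - theta \<alpha> \<rho> \<gamma> \<sigma> \<beta> \<delta> \<mu> \<nu> x) * Phi p \<sigma> \<delta> \<mu> x"

definition Psi :: "real \<Rightarrow> real \<Rightarrow> real \<Rightarrow> (nat \<Rightarrow> real) \<Rightarrow> nat \<Rightarrow> real" where
  "Psi q \<sigma> \<beta> \<nu> n = (V \<nu> n - \<beta>) powr (q * (1 - \<sigma>) - 1) / \<nu> (n + 1) powr (q - 1)"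

text \<open>Formal norms: the exponents \<open>p < 1\<close> and \<open>q < 0\<close> are allowed.\<close>

definition norm_fun :: "real \<Rightarrow> (real \<Rightarrow> real) \<Rightarrow> (real \<Rightarrow> real) \<Rightarrow> ennreal" where
  "norm_fun p w f =
     epowr (\<integral>\<^sup>+ x\<in>{0<..}. ennreal (w x) * epowr (ennreal (f x)) p \<partial>lebesgue) (1 / p)"

definition norm_seq :: "real \<Rightarrow> (nat \<Rightarrow> real) \<Rightarrow> (nat \<Rightarrow> real) \<Rightarrow> ennreal" where
  "norm_seq q w a =
     epowr (\<Sum>n. ennreal (w (Suc n)) * epowr (ennreal (a (Suc n))) q) (1 / q)"

definition admissible ::
  "real \<Rightarrow> real \<Rightarrow> real \<Rightarrow> real \<Rightarrow> real \<Rightarrow> (real \<Rightarrow> real) \<Rightarrow> (nat \<Rightarrow> real) \<Rightarrow>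
   (real \<Rightarrow> real) \<Rightarrow> (nat \<Rightarrow> real) \<Rightarrow> bool" where
  "admissible p q \<sigma> \<beta> \<delta> \<mu> \<nu> f a \<longleftrightarrow>
     f \<in> borel_measurable (lebesgue_on {0<..}) \<and> (\<forall>x>0. 0 \<le> f x) \<and> (\<forall>n\<ge>1. 0 \<le> a n) \<and>
     0 < norm_fun p (Phi p \<sigma> \<delta> \<mu>) f \<and> norm_fun p (Phi p \<sigma> \<delta> \<mu>) f < \<infinity> \<and>
     0 < norm_seq q (Psi q \<sigma> \<beta> \<nu>) a \<and> norm_seq q (Psi q \<sigma> \<beta> \<nu>) a < \<infinity>"

text \<open>
  Left-hand sides of the three inequalities: the bilinear form, the norm of the transform of
  \<open>f\<close>, and the norm of the transform of \<open>a\<close>.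
\<close>

definition bilinear_lhs ::
  "real \<Rightarrow> real \<Rightarrow> real \<Rightarrow> real \<Rightarrow> real \<Rightarrow> (real \<Rightarrow> real) \<Rightarrow> (nat \<Rightarrow> real) \<Rightarrow>
   (real \<Rightarrow> real) \<Rightarrow> (nat \<Rightarrow> real) \<Rightarrow> ennreal" where
  "bilinear_lhs \<alpha> \<rho> \<gamma> \<beta> \<delta> \<mu> \<nu> f a =
     (\<Sum>n. \<integral>\<^sup>+ x\<in>{0<..}. ennreal (kernel \<alpha> \<rho> \<gamma> \<beta> \<delta> \<mu> \<nu> x (Suc n) * a (Suc n) * f x) \<partial>lebesgue)"

definition fun_transform_lhs ::
  "real \<Rightarrow> real \<Rightarrow> real \<Rightarrow> real \<Rightarrow> real \<Rightarrow> real \<Rightarrow> real \<Rightarrow> (real \<Rightarrow> real) \<Rightarrow> (nat \<Rightarrow> real) \<Rightarrow>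
   (real \<Rightarrow> real) \<Rightarrow> ennreal" where
  "fun_transform_lhs p \<alpha> \<rho> \<gamma> \<sigma> \<beta> \<delta> \<mu> \<nu> f =
     epowr (\<Sum>n. ennreal (\<nu> (Suc n + 1) / (V \<nu> (Suc n) - \<beta>) powr (1 - p * \<sigma>)) *
               epowr (\<integral>\<^sup>+ x\<in>{0<..}. ennreal (kernel \<alpha> \<rho> \<gamma> \<beta> \<delta> \<mu> \<nu> x (Suc n) * f x) \<partial>lebesgue) p)
           (1 / p)"

definition seq_transform_lhs ::
  "real \<Rightarrow> real \<Rightarrow> real \<Rightarrow> real \<Rightarrow> real \<Rightarrow> real \<Rightarrow> real \<Rightarrow> (real \<Rightarrow> real) \<Rightarrow> (nat \<Rightarrow> real) \<Rightarrow>
   (nat \<Rightarrow> real) \<Rightarrow> ennreal" where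
  "seq_transform_lhs q \<alpha> \<rho> \<gamma> \<sigma> \<beta> \<delta> \<mu> \<nu> a =
     epowr (\<integral>\<^sup>+ x\<in>{0<..}.
               ennreal ((1 - theta \<alpha> \<rho> \<gamma> \<sigma> \<beta> \<delta> \<mu> \<nu> x) powr (1 - q) * \<mu> x
                        / U \<mu> x powr (1 - q * \<delta> * \<sigma>)) *
               epowr (\<Sum>n. ennreal (kernel \<alpha> \<rho> \<gamma> \<beta> \<delta> \<mu> \<nu> x (Suc n) * a (Suc n))) q \<partial>lebesgue)
           (1 / q)"

text \<open>
  The three inequalities, with a constant \<open>c\<close> in place of \<open>k_const\<close>, for all admissible
  \<open>f\<close> and \<open>a\<close>.
\<close>

definition bilinear_ineq ::
  "real \<Rightarrow> real \<Rightarrow> real \<Rightarrow> real \<Rightarrow> real \<Rightarrow> real \<Rightarrow> real \<Rightarrow> real \<Rightarrow> (real \<Rightarrow> real) \<Rightarrow> (nat \<Rightarrow> real) \<Rightarrow>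
   real \<Rightarrow> bool" where
  "bilinear_ineq p q \<alpha> \<rho> \<gamma> \<sigma> \<beta> \<delta> \<mu> \<nu> c \<longleftrightarrow>
     (\<forall>f a. admissible p q \<sigma> \<beta> \<delta> \<mu> \<nu> f a \<longrightarrow>
        bilinear_lhs \<alpha> \<rho> \<gamma> \<beta> \<delta> \<mu> \<nu> f a
        > ennreal c * norm_fun p (Phi_tilde p \<alpha> \<rho> \<gamma> \<sigma> \<beta> \<delta> \<mu> \<nu>) f * norm_seq q (Psi q \<sigma> \<beta> \<nu>) a)"

definition fun_transform_ineq ::
  "real \<Rightarrow> real \<Rightarrow> real \<Rightarrow> real \<Rightarrow> real \<Rightarrow> real \<Rightarrow> real \<Rightarrow> real \<Rightarrow> (real \<Rightarrow> real) \<Rightarrow> (nat \<Rightarrow> real) \<Rightarrow>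
   real \<Rightarrow> bool" where
  "fun_transform_ineq p q \<alpha> \<rho> \<gamma> \<sigma> \<beta> \<delta> \<mu> \<nu> c \<longleftrightarrow>
     (\<forall>f a. admissible p q \<sigma> \<beta> \<delta> \<mu> \<nu> f a \<longrightarrow>
        fun_transform_lhs p \<alpha> \<rho> \<gamma> \<sigma> \<beta> \<delta> \<mu> \<nu> f
        > ennreal c * norm_fun p (Phi_tilde p \<alpha> \<rho> \<gamma> \<sigma> \<beta> \<delta> \<mu> \<nu>) f)"

definition seq_transform_ineq ::
  "real \<Rightarrow> real \<Rightarrow> real \<Rightarrow> real \<Rightarrow> real \<Rightarrow> real \<Rightarrow> real \<Rightarrow> real \<Rightarrow> (real \<Rightarrow> real) \<Rightarrow> (nat \<Rightarrow> real) \<Rightarrow>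
   real \<Rightarrow> bool" where
  "seq_transform_ineq p q \<alpha> \<rho> \<gamma> \<sigma> \<beta> \<delta> \<mu> \<nu> c \<longleftrightarrow>
     (\<forall>f a. admissible p q \<sigma> \<beta> \<delta> \<mu> \<nu> f a \<longrightarrow>
        seq_transform_lhs q \<alpha> \<rho> \<gamma> \<sigma> \<beta> \<delta> \<mu> \<nu> a
        > ennreal c * norm_seq q (Psi q \<sigma> \<beta> \<nu>) a)"

end

theory Submission
  imports Defs
begin

text \<open>
  Put \<open>h u = csch (\<rho> u^\<gamma>) / exp (\<alpha> u^\<gamma>)\<close>, so that the kernel is \<open>h (U^\<delta> (x) (V_n - \<beta>))\<close>.  The substitution
  \<open>u = U^\<delta> (x) (V_n - \<beta>)\<close> evaluates the weight integral over \<open>x\<close> exactly.  The weight sum over \<open>n\<close> exceeds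
  the tail integral of \<open>h u * u^(\<sigma> - 1)\<close> beyond \<open>U^\<delta> (x) (\<nu>_1 - \<beta>)\<close>, that is \<open>k(\<sigma>) (1 - \<theta>(x))\<close>,
  because this function is strictly decreasing for \<open>\<sigma> \<le> 1\<close>; no upper bound for the weight sum is needed.
  With these two weights, pointwise Hoelder gives the second and the third inequality with \<open>k(\<sigma>)\<close>, and another
  application shows that either of them, with any constant, implies the first with the same constant.

  For optimality it therefore suffices to test the first inequality, on
  \<open>f = \<mu> U^(\<delta>(\<sigma> + e/p) - 1)\<close>, restricted to a region \<open>U^\<delta> \<le> r\<close> on which \<open>\<theta>\<close> is small, and
  \<open>a_n = \<nu>_(n+1) (V_n - \<beta>)^(\<sigma> - e/q - 1)\<close>, letting \<open>e\<close> tend to \<open>0\<close>.  All three inequalities thus hold exactly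
  for the constants up to \<open>k(\<sigma>)\<close>, which makes them equivalent for each constant.
\<close>

section \<open>Extended powers and Hoelder's inequality\<close>

text \<open>The factor \<open>1 - \<theta> x\<close> accounts for the head of the integral that a
  Riemann sum starting at its first node cannot see. The nodes are \<open>Y x * s n\<close>, and
  their gaps \<open>Y x * \<nu> (n + 2)\<close> explain the shifted terms of \<open>\<nu>\<close> in
  the weights. Reverse Hoelder for \<open>p < 1\<close> and \<open>q < 0\<close> is ordinary Hoelder
  with exponents \<open>p\<close> and \<open>1 - p\<close>, solved for one factor:
  \<open>1 / q = - (1 - p) / p\<close>, so it remains to divide by a power of a positive finite
  quantity. The obstacle is the arithmetic of \<open>[0, \<infinity>]\<close>: since
  \<open>0 * top = 0\<close> spoils such factorisations, positivity and finiteness are secured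
  before each division. Strictness arises pointwise, in the weight sum; it survives integration
  because the smaller integral is finite and the set where it is strict is not null. The test
  exponents \<open>e / p\<close> and \<open>- e / q\<close> make one and the same sum govern the
  norm of the sequence and the bilinear form. The norm integral of the test function and the bound
  for that sum grow like \<open>1 / e\<close>, so multiplying by \<open>e powr (1 / p)\<close>
  leaves only the constants in the limit.\<close>

lemma ennreal_zero_top_cases [case_names zero top real]:
  fixes x :: ennreal
  obtains "x = 0" | "x = top" | r where "0 < r" "x = ennreal r"
proof (cases x)
  case (real r)
  then show ?thesis using that(1,3) by (cases "r = 0") auto
next
  case top
  then show ?thesis using that(2) by simp
qed

lemma epowr_ennreal: "0 < x \<Longrightarrow> epowr (ennreal x) r = ennreal (x powr r)"
  by (auto simp: epowr_def)

lemma epowr_0: "epowr 0 r = (if r = 0 then 1 else if r < 0 then top else 0)"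
  by (simp add: epowr_def)

lemma epowr_top: "epowr top r = (if r = 0 then 1 else if r < 0 then 0 else top)"
  by (simp add: epowr_def)

lemma measurable_epowr [measurable]:
  assumes [measurable]: "f \<in> borel_measurable M"
  shows "(\<lambda>x. epowr (f x) r) \<in> borel_measurable M"
  unfolding epowr_def by measurable

text \<open>Transfers positivity and finiteness between a formal norm and the integral or sum under
  its root. For a negative exponent the two conditions trade places.\<close>

lemma epowr_pos_finite:
  "0 < r \<Longrightarrow> 0 < epowr x r \<longleftrightarrow> 0 < x"
  "0 < r \<Longrightarrow> epowr x r < top \<longleftrightarrow> x < top"
  "r < 0 \<Longrightarrow> 0 < epowr x r \<longleftrightarrow> x < top"
  "r < 0 \<Longrightarrow> epowr x r < top \<longleftrightarrow> 0 < x"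
  by (simp_all add: epowr_def zero_less_iff_neq_zero less_top ennreal_eq_0_iff enn2real_eq_0_iff split: if_splits)

lemma powr_less_powr_iff:
  fixes x y r :: real
  shows "0 < r \<Longrightarrow> 0 < x \<Longrightarrow> 0 < y \<Longrightarrow> x powr r < y powr r \<longleftrightarrow> x < y"
  by (meson less_imp_le powr_less_cancel2 powr_less_mono2)

lemma epowr_less_iff:
  assumes "0 < r" shows "epowr x r < epowr y r \<longleftrightarrow> x < y"
proof (cases x rule: ennreal_zero_top_cases)
  case zero
  then show ?thesis using assms epowr_pos_finite(1)[of r y] by (simp add: epowr_0)
next
  case top
  then show ?thesis using assms by (simp add: epowr_top)
next
  case (real a)
  then show ?thesis
    by (cases y rule: ennreal_zero_top_cases)
      (use assms in \<open>simp_all add: epowr_ennreal epowr_0 epowr_top ennreal_less_iff powr_less_powr_iff\<close>)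
qed

lemma epowr_less_neg:
  assumes "r < 0" "x < y" shows "epowr y r < epowr x r"
  by (cases x rule: ennreal_zero_top_cases; cases y rule: ennreal_zero_top_cases)
    (use assms in \<open>auto simp: epowr_ennreal epowr_0 epowr_top ennreal_less_iff powr_less_mono2_neg\<close>)

lemma epowr_epowr:
  assumes "r \<noteq> 0" "s \<noteq> 0" shows "epowr (epowr x r) s = epowr x (r * s)"
  by (cases x rule: ennreal_zero_top_cases)
    (use assms in \<open>auto simp: epowr_ennreal epowr_0 epowr_top powr_powr zero_less_mult_iff mult_less_0_iff\<close>)

lemma epowr_1: "epowr x 1 = x"
  by (cases x rule: ennreal_zero_top_cases) (auto simp: epowr_ennreal epowr_0 epowr_top)

text \<open>The sign of \<open>r\<close> matters: for \<open>r < 0\<close>, \<open>x = 0\<close>,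
  \<open>y = top\<close> the left side is \<open>top\<close>, the right side
  \<open>0\<close>.\<close>

lemma epowr_mult:
  assumes "0 < r" shows "epowr (x * y) r = epowr x r * epowr y r"
  by (cases x rule: ennreal_zero_top_cases; cases y rule: ennreal_zero_top_cases)
    (use assms in \<open>auto simp: epowr_ennreal epowr_0 epowr_top powr_mult ennreal_mult_top ennreal_top_mult
       ennreal_mult[symmetric]\<close>)

text \<open>Weighted AM-GM for \<open>x / a\<close> and \<open>y / b\<close>. The free scales become
  the two integrals in Hoelder's inequality.\<close>

lemma epowr_Young:
  assumes s: "0 < s" "s < 1" and ab: "0 < a" "0 < b"
  shows "epowr x s * epowr y (1 - s) \<le>
    ennreal (a powr s * b powr (1 - s)) * (ennreal (s / a) * x + ennreal ((1 - s) / b) * y)"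
proof (cases "x = top \<or> y = top")
  case True
  then show ?thesis using s ab by (auto simp: ennreal_mult_top)
next
  case False
  show ?thesis
  proof (cases "x = 0 \<or> y = 0")
    case True
    then show ?thesis using s by (auto simp: epowr_0)
  next
    case nz: False
    obtain u where u: "0 < u" "x = ennreal u"
      using False nz by (cases x rule: ennreal_zero_top_cases) auto
    obtain v where v: "0 < v" "y = ennreal v"
      using False nz by (cases y rule: ennreal_zero_top_cases) auto
    have "(u / a) powr s * (v / b) powr (1 - s) \<le> s * (u / a) + (1 - s) * (v / b)"
      by (rule Youngs_inequality_0) (use s ab u v in auto)
    then have "(a powr s * b powr (1 - s)) * ((u / a) powr s * (v / b) powr (1 - s)) \<le>
        (a powr s * b powr (1 - s)) * (s * (u / a) + (1 - s) * (v / b))"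
      by (rule mult_left_mono) simp
    moreover have "(a powr s * b powr (1 - s)) * ((u / a) powr s * (v / b) powr (1 - s)) =
        u powr s * v powr (1 - s)"
      using ab u v by (simp add: powr_divide)
    ultimately have *: "u powr s * v powr (1 - s) \<le>
        (a powr s * b powr (1 - s)) * (s * (u / a) + (1 - s) * (v / b))"
      by simp
    show ?thesis
      using u v ab s *
      by (simp add: epowr_ennreal ennreal_mult[symmetric] ennreal_plus[symmetric]
          ennreal_le_iff del: ennreal_plus)
  qed
qed

text \<open>Exponents adding up to 1 give one form for integrals and, over
  \<open>count_space\<close>, for sums; it is applied with \<open>s = p\<close>,
  \<open>s = 1 - p\<close> and \<open>s = 1 / (1 - q)\<close>.\<close>

lemma nn_integral_Hoelder:
  assumes [measurable]: "A \<in> borel_measurable M" "B \<in> borel_measurable M"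
    and s: "0 < s" "s < 1"
  shows "(\<integral>\<^sup>+x. epowr (A x) s * epowr (B x) (1 - s) \<partial>M) \<le>
    epowr (\<integral>\<^sup>+x. A x \<partial>M) s * epowr (\<integral>\<^sup>+x. B x \<partial>M) (1 - s)"
proof -
  let ?a = "\<integral>\<^sup>+x. A x \<partial>M" and ?b = "\<integral>\<^sup>+x. B x \<partial>M"
  \<comment> \<open>A zero integral is treated apart from an infinite one: if the other integral is
    \<open>top\<close>, the right side is \<open>0 * top = 0\<close>, and the left side really has
    to vanish.\<close>
  have zero: ?thesis if "?a = 0 \<or> ?b = 0"
  proof -
    have "(AE x in M. A x = 0) \<or> (AE x in M. B x = 0)"
      using that by (simp add: nn_integral_0_iff_AE)
    then have "AE x in M. epowr (A x) s * epowr (B x) (1 - s) = 0"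
      using s by (auto simp: epowr_0 elim!: eventually_mono)
    then show ?thesis by (subst nn_integral_0_iff_AE[THEN iffD2]) simp_all
  qed
  show ?thesis
  proof (cases ?a rule: ennreal_zero_top_cases)
    case zero
    then show ?thesis using \<open>?a = 0 \<or> ?b = 0 \<Longrightarrow> ?thesis\<close> by blast
  next
    case top
    show ?thesis
    proof (cases "?b = 0")
      case False
      then have "epowr ?b (1 - s) \<noteq> 0"
        using epowr_pos_finite(1)[of "1 - s" ?b] s by (auto simp: zero_less_iff_neq_zero)
      then show ?thesis using top s by (simp add: epowr_top ennreal_top_mult)
    qed (use zero in blast)
  next
    case (real a)
    show ?thesis
    proof (cases ?b rule: ennreal_zero_top_cases)
      case zero
      then show ?thesis using \<open>?a = 0 \<or> ?b = 0 \<Longrightarrow> ?thesis\<close> by blast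
    next
      case top
      then show ?thesis using real s by (simp add: epowr_top epowr_ennreal ennreal_mult_top)
    next
      case (real b)
      note b = this and a = \<open>0 < a\<close> \<open>?a = ennreal a\<close>
      have "(\<integral>\<^sup>+x. epowr (A x) s * epowr (B x) (1 - s) \<partial>M) \<le>
          (\<integral>\<^sup>+x. ennreal (a powr s * b powr (1 - s)) *
             (ennreal (s / a) * A x + ennreal ((1 - s) / b) * B x) \<partial>M)"
        by (intro nn_integral_mono epowr_Young s a(1) b(1))
      also have "\<dots> = ennreal (a powr s * b powr (1 - s)) *
             (ennreal (s / a) * ?a + ennreal ((1 - s) / b) * ?b)"
        by (simp add: nn_integral_cmult nn_integral_add)
      \<comment> \<open>With \<open>a\<close> and \<open>b\<close> equal to the integrals, the
        bracket is \<open>s + (1 - s) = 1\<close>.\<close>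
      also have "\<dots> = ennreal (a powr s * b powr (1 - s))"
        using a b s by (simp add: ennreal_mult[symmetric] ennreal_plus[symmetric] del: ennreal_plus)
      also have "\<dots> = epowr ?a s * epowr ?b (1 - s)"
        using a b by (simp add: epowr_ennreal ennreal_mult)
      finally show ?thesis .
    qed
  qed
qed

lemma ennreal_mult_strict_right_mono:
  "a < b \<Longrightarrow> 0 < c \<Longrightarrow> c < \<infinity> \<Longrightarrow> a * c < b * (c :: ennreal)"
  by (subst (1 2) mult.commute) (rule ennreal_mult_strict_left_mono; simp)

text \<open>Turns identities between products of powers into ring identities between logarithms.\<close>

lemma ln_eq_imp_eq: "0 < x \<Longrightarrow> 0 < y \<Longrightarrow> ln x = ln y \<Longrightarrow> x = (y::real)"
  by simp

text \<open>The right side is the integral of \<open>u powr (- 1 - e)\<close> over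
  \<open>{a..b}\<close>, the left side its rectangle at the right endpoint. The proof avoids the
  integral, using \<open>1 - x \<le> - ln x\<close> at \<open>x = a / b\<close> and
  \<open>1 + y \<le> exp y\<close>.\<close>

lemma powr_difference_bound:
  fixes a b e :: real
  assumes "0 < a" "a < b" "0 < e"
  shows "(b - a) * b powr (- 1 - e) \<le> (a powr (- e) - b powr (- e)) / e"
proof -
  have "ln (a / b) \<le> a / b - 1"
    using assms by (intro ln_le_minus_one) simp
  then have "e * (1 - a / b) \<le> e * (- ln (a / b))"
    using assms by (intro mult_left_mono) auto
  also have "\<dots> \<le> exp (e * (- ln (a / b))) - 1"
    using exp_ge_add_one_self[of "e * (- ln (a / b))"] by linarith
  also have "exp (e * (- ln (a / b))) = (a / b) powr (- e)"
    using assms by (simp add: powr_def)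
  also have "\<dots> = a powr (- e) * b powr e"
    using assms by (simp add: powr_divide powr_minus field_simps)
  finally have "b powr (- e) * (e * (1 - a / b)) \<le> b powr (- e) * (a powr (- e) * b powr e - 1)"
    by (intro mult_left_mono) auto
  moreover have "b powr (- e) * (e * (1 - a / b)) = e * ((b - a) * b powr (- 1 - e))"
  proof -
    have "b powr (- e) = b * b powr (- 1 - e)"
      using powr_mult_base[of b "- 1 - e"] assms by simp
    then show ?thesis using assms by (simp add: field_simps)
  qed
  moreover have "b powr (- e) * (a powr (- e) * b powr e - 1) = a powr (- e) - b powr (- e)"
    using assms by (simp add: algebra_simps powr_minus)
  ultimately have "e * ((b - a) * b powr (- 1 - e)) \<le> a powr (- e) - b powr (- e)"
    by (simp only:)
  then show ?thesis using assms by (simp add: pos_le_divide_eq mult.commute)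
qed

section \<open>Integrals of real functions over subsets of the line\<close>

lemma set_integrable_lborel_nonneg:
  fixes f :: "real \<Rightarrow> real"
  assumes "f integrable_on A" "\<And>x. x \<in> A \<Longrightarrow> 0 \<le> f x" and [measurable]: "f \<in> borel_measurable borel" "A \<in> sets borel"
  shows "set_integrable lborel A f"
proof -
  have "f absolutely_integrable_on A"
    using assms by (simp add: absolutely_integrable_on_iff_nonneg)
  then show ?thesis
    unfolding set_integrable_def by (subst (asm) integrable_completion) auto
qed

lemma set_nn_integral_eq_set_lebesgue_integral:
  fixes f :: "'a \<Rightarrow> real"
  assumes "set_integrable M A f" "\<And>x. x \<in> A \<Longrightarrow> 0 \<le> f x"
  shows "(\<integral>\<^sup>+x\<in>A. ennreal (f x) \<partial>M) = ennreal (LINT x:A|M. f x)"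
proof -
  have "(\<integral>\<^sup>+x\<in>A. ennreal (f x) \<partial>M) = (\<integral>\<^sup>+x. ennreal (indicator A x *\<^sub>R f x) \<partial>M)"
    by (intro nn_integral_cong) (auto simp: indicator_def)
  also have "\<dots> = ennreal (LINT x:A|M. f x)"
    unfolding set_lebesgue_integral_def
    by (rule nn_integral_eq_integral) (use assms in \<open>auto simp: set_integrable_def indicator_def\<close>)
  finally show ?thesis .
qed

text \<open>Dominated convergence along the intervals \<open>{0<..b / Suc n}\<close>. Applied to the
  profile it makes \<open>\<theta>\<close> small; applied to \<open>\<mu>\<close> it yields
  arbitrarily small values of \<open>U \<mu>\<close>.\<close>

lemma set_integral_initial_small:
  fixes f :: "real \<Rightarrow> real"
  assumes "set_integrable lborel {0<..b} f" "0 < b" "0 < \<eta>"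
  obtains r where "0 < r" "r \<le> b" "\<bar>LINT u:{0<..r}|lborel. f u\<bar> < \<eta>"
proof -
  define F where "F u = indicator {0<..b} u *\<^sub>R f u" for u
  have F: "integrable lborel F"
    using assms(1) unfolding set_integrable_def F_def .
  have eq: "indicator {0<..b / Suc n} u *\<^sub>R f u = indicator {0<..b / Suc n} u *\<^sub>R F u" for n u
  proof -
    have "b / Suc n \<le> b" using assms(2) by (simp add: field_simps)
    then show ?thesis by (auto simp: F_def split: split_indicator)
  qed
  have "(\<lambda>n. LINT u|lborel. indicator {0<..b / Suc n} u *\<^sub>R F u) \<longlonglongrightarrow> (LINT (u::real)|lborel. (0::real))"
  proof (rule integral_dominated_convergence)
    show "integrable lborel (\<lambda>u. \<bar>F u\<bar>)"
      using F by (rule integrable_abs)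
    have "(\<lambda>n. indicator {0<..b / Suc n} u *\<^sub>R F u) \<longlonglongrightarrow> 0" for u
    proof (cases "0 < u")
      case True
      obtain N where N: "inverse (real (Suc N)) < u / b"
        using reals_Archimedean[of "u / b"] True assms(2) by auto
      have "u \<notin> {0<..b / real (Suc n)}" if "N \<le> n" for n
      proof -
        have "b / real (Suc n) \<le> b / real (Suc N)"
          using that assms(2) by (intro divide_left_mono) auto
        also have "\<dots> < u" using N assms(2) by (simp add: field_simps)
        finally show ?thesis by auto
      qed
      then have "eventually (\<lambda>n. indicator {0<..b / Suc n} u *\<^sub>R F u = 0) sequentially"
        by (auto simp: eventually_sequentially intro!: exI[of _ N])
      then show ?thesis by (rule tendsto_eventually)
    qed simp
    then show "AE u in lborel. (\<lambda>n. indicator {0<..b / Suc n} u *\<^sub>R F u) \<longlonglongrightarrow> 0" by simp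
    show "AE u in lborel. norm (indicator {0<..b / Suc n} u *\<^sub>R F u) \<le> \<bar>F u\<bar>" for n
      by (auto split: split_indicator)
  qed (use F in auto)
  then have "(\<lambda>n. LINT u:{0<..b / Suc n}|lborel. f u) \<longlonglongrightarrow> 0"
    by (simp only: set_lebesgue_integral_def eq) simp
  then have "eventually (\<lambda>n. \<bar>LINT u:{0<..b / Suc n}|lborel. f u\<bar> < \<eta>) sequentially"
    using assms(3) by (auto dest!: tendstoD simp: dist_real_def)
  then obtain n where "\<bar>LINT u:{0<..b / Suc n}|lborel. f u\<bar> < \<eta>"
    by (auto simp: eventually_sequentially)
  moreover have "b / Suc n \<le> b" using assms(2) by (simp add: field_simps)
  ultimately show thesis using assms(2) by (intro that[of "b / Suc n"]) auto
qed

section \<open>The profile of the kernel\<close>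

locale csch_kernel =
  fixes \<alpha> \<rho> \<gamma> :: real
  assumes rho: "\<rho> > max 0 (- \<alpha>)" and gamma: "0 < \<gamma>"
begin

definition h :: "real \<Rightarrow> real" where
  "h u = csch (\<rho> * u powr \<gamma>) / exp (\<alpha> * u powr \<gamma>)"

definition g :: "real \<Rightarrow> real \<Rightarrow> real" where
  "g s u = h u * u powr (s - 1)"

lemma rho_pos: "0 < \<rho>" and sum_pos: "0 < \<alpha> + \<rho>"
  using rho by auto

text \<open>Extracting \<open>exp (\<rho> * u powr \<gamma>)\<close> from the csch leaves a
  denominator with two positive increasing factors, because \<open>\<alpha> + \<rho> > 0\<close> and
  \<open>\<rho> > 0\<close>.\<close>

lemma h_altdef: "h u = 2 / (exp ((\<alpha> + \<rho>) * u powr \<gamma>) * (1 - exp (- (2 * \<rho> * u powr \<gamma>))))"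
proof -
  have "exp (\<alpha> * v) * (exp (\<rho> * v) - exp (- (\<rho> * v))) =
      exp ((\<alpha> + \<rho>) * v) * (1 - exp (- (2 * \<rho> * v)))" for v
    by (simp add: algebra_simps flip: exp_add)
  note eq = this[of "u powr \<gamma>"]
  have "h u = 2 / (exp (\<alpha> * u powr \<gamma>) * (exp (\<rho> * u powr \<gamma>) - exp (- (\<rho> * u powr \<gamma>))))"
    by (simp add: h_def csch_def mult.commute)
  then show ?thesis by (simp only: eq mult.assoc)
qed

lemma h_denominator_pos:
  assumes "0 < u"
  shows "0 < exp ((\<alpha> + \<rho>) * u powr \<gamma>) * (1 - exp (- (2 * \<rho> * u powr \<gamma>)))"
  using assms rho_pos by simp

lemma h_pos: "0 < u \<Longrightarrow> 0 < h u"
  using h_denominator_pos by (simp add: h_altdef)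

lemma h_less:
  assumes "0 < u" "u < w" shows "h w < h u"
proof -
  have v: "u powr \<gamma> < w powr \<gamma>" using assms gamma by (intro powr_less_mono2) auto
  have "exp ((\<alpha> + \<rho>) * u powr \<gamma>) * (1 - exp (- (2 * \<rho> * u powr \<gamma>))) <
      exp ((\<alpha> + \<rho>) * w powr \<gamma>) * (1 - exp (- (2 * \<rho> * w powr \<gamma>)))"
    by (rule mult_strict_mono) (use v rho_pos sum_pos assms in \<open>simp_all add: mult_strict_left_mono\<close>)
  moreover have "0 < u" "0 < w" using assms by auto
  ultimately show ?thesis
    unfolding h_altdef
    by (intro divide_strict_left_mono mult_pos_pos h_denominator_pos) simp_all
qed

lemma g_pos: "0 < u \<Longrightarrow> 0 < g s u"
  by (simp add: g_def h_pos)

lemma g_less: "0 < u \<Longrightarrow> u < w \<Longrightarrow> s \<le> 1 \<Longrightarrow> g s w < g s u"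
  unfolding g_def using h_pos[of w] by (intro mult_less_le_imp_less h_less powr_mono2') auto

lemma measurable_h [measurable]: "h \<in> borel_measurable borel"
  unfolding h_def csch_def by measurable

lemma measurable_g [measurable]: "g s \<in> borel_measurable borel"
  unfolding g_def by measurable

text \<open>Separates the decay at infinity from the singularity of order
  \<open>u powr (- \<gamma>)\<close> at 0.\<close>

lemma h_le:
  assumes "0 < u"
  shows "h u \<le> exp (- ((\<alpha> + \<rho>) * u powr \<gamma>)) * (1 / (\<rho> * u powr \<gamma>) + 2)"
proof -
  define x where "x = 2 * \<rho> * u powr \<gamma>"
  have x: "0 < x" using assms rho_pos by (simp add: x_def)
  \<comment> \<open>The left side is \<open>1 + 1 / (exp x - 1)\<close>, and
    \<open>exp x - 1 \<ge> x\<close>.\<close>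
  have "1 / (1 - exp (- x)) \<le> 1 / x + 1"
    using exp_ge_add_one_self[of x] x
    by (simp add: exp_minus field_simps)
  then have "2 * exp (- ((\<alpha> + \<rho>) * u powr \<gamma>)) * (1 / (1 - exp (- x))) \<le>
      2 * exp (- ((\<alpha> + \<rho>) * u powr \<gamma>)) * (1 / x + 1)"
    by (intro mult_left_mono) auto
  moreover have "h u = 2 * exp (- ((\<alpha> + \<rho>) * u powr \<gamma>)) * (1 / (1 - exp (- x)))"
    by (simp add: h_altdef x_def exp_minus[of "(\<alpha> + \<rho>) * u powr \<gamma>"] divide_inverse)
  moreover have "2 * (1 / x + 1) = 1 / (\<rho> * u powr \<gamma>) + 2"
    by (simp add: x_def)
  ultimately show ?thesis by (simp only: mult.assoc mult.left_commute[of 2])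
qed

text \<open>From \<open>(1 + y / N) ^ N \<le> exp y\<close> at
  \<open>y = l * u powr \<gamma>\<close>: once \<open>\<gamma> * N \<ge> r\<close>, the constant
  \<open>C = (N / l) ^ N\<close> works.\<close>

lemma exp_decay:
  assumes "0 < l"
  obtains C where "0 < C" "\<And>u. 1 \<le> u \<Longrightarrow> exp (- (l * u powr \<gamma>)) \<le> C * u powr (- r)"
proof -
  obtain N :: nat where N: "max 1 (r / \<gamma>) < real N" using reals_Archimedean2 by blast
  then have N0: "0 < N" and Nr: "r \<le> \<gamma> * N" using gamma by (auto simp: field_simps)
  have "exp (- (l * u powr \<gamma>)) \<le> (N / l) ^ N * u powr (- r)" if "1 \<le> u" for u
  proof -
    have "u powr r \<le> u powr (\<gamma> * N)" using that Nr by (intro powr_mono)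
    also have "\<dots> = (u powr \<gamma>) ^ N" using that by (simp add: powr_powr[symmetric] powr_realpow)
    finally have 1: "u powr r \<le> (u powr \<gamma>) ^ N" .
    have "(l * u powr \<gamma> / N) ^ N \<le> (1 + l * u powr \<gamma> / N) ^ N"
      using assms by (intro power_mono) auto
    also have "\<dots> \<le> exp (l * u powr \<gamma>)"
      using N0 assms by (intro exp_ge_one_plus_x_over_n_power_n) (auto intro: order_trans[of _ 0])
    finally have "(l / N) ^ N * (u powr \<gamma>) ^ N \<le> exp (l * u powr \<gamma>)"
      by (simp add: power_mult_distrib power_divide)
    then have *: "(l / N) ^ N * u powr r \<le> exp (l * u powr \<gamma>)"
      using assms by (intro order_trans[OF mult_left_mono[OF 1]]) auto
    have "exp (- (l * u powr \<gamma>)) \<le> inverse ((l / N) ^ N * u powr r)"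
      unfolding exp_minus by (rule le_imp_inverse_le) (use * assms N0 that in auto)
    also have "\<dots> = (N / l) ^ N * u powr (- r)"
      using assms N0 by (simp add: powr_minus power_divide field_simps)
    finally show ?thesis .
  qed
  then show thesis using that[of "(N / l) ^ N"] assms N0 by auto
qed

text \<open>Near 0 the integrand is of order \<open>u powr (s - \<gamma> - 1)\<close>, which is
  integrable exactly because \<open>\<gamma> < s\<close>.\<close>

lemma g_integrable:
  assumes "\<gamma> < s" shows "set_integrable lborel {0<..} (g s)"
proof -
  \<comment> \<open>One constant for both halves: \<open>1 / (\<rho> * u powr \<gamma>) + 2\<close>
    is at most \<open>D * u powr (- \<gamma>)\<close> for \<open>u \<le> 1\<close> and at most
    \<open>D\<close> for \<open>u \<ge> 1\<close>.\<close>
  define D where "D = 1 / \<rho> + 2"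
  have D: "0 < D" using rho_pos by (simp add: D_def add_pos_pos)
  have "set_integrable lborel {0<..1} (g s)"
  proof (rule set_integrable_bound)
    show "set_integrable lborel {0<..1} (\<lambda>u. D * u powr (s - \<gamma> - 1))"
      using assms by (intro set_integrable_mult_right set_integrable_lborel_nonneg integrable_on_powr_from_0') auto
    have "g s u \<le> D * u powr (s - \<gamma> - 1)" if u: "0 < u" "u \<le> 1" for u
    proof -
      have u1: "u powr \<gamma> \<le> 1" using u gamma by (intro powr_le1) auto
      have "h u \<le> 1 * (1 / (\<rho> * u powr \<gamma>) + 2)"
        by (rule order_trans[OF h_le[OF u(1)]]) (use sum_pos rho_pos in \<open>intro mult_right_mono, auto\<close>)
      also have "\<dots> \<le> D * u powr (- \<gamma>)"
        using u u1 rho_pos by (simp add: D_def powr_minus field_simps)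
      finally have "g s u \<le> D * u powr (- \<gamma>) * u powr (s - 1)"
        unfolding g_def by (intro mult_right_mono) auto
      then show ?thesis using u by (simp add: powr_add[symmetric] algebra_simps)
    qed
    then show "AE u in lborel. u \<in> {0<..1} \<longrightarrow> norm (g s u) \<le> norm (D * u powr (s - \<gamma> - 1))"
      using g_pos[of _ s] D by (auto simp: abs_of_pos abs_mult)
  qed (simp add: set_borel_measurable_def)
  moreover have "set_integrable lborel {1..} (g s)"
  proof -
    \<comment> \<open>The exponent \<open>- (s + 1)\<close> is chosen so that the product with
      \<open>u powr (s - 1)\<close> is \<open>u powr (- 2)\<close>.\<close>
    obtain C where C: "0 < C" "\<And>u. 1 \<le> u \<Longrightarrow> exp (- ((\<alpha> + \<rho>) * u powr \<gamma>)) \<le> C * u powr (- (s + 1))"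
      using exp_decay[OF sum_pos] by blast
    show ?thesis
    proof (rule set_integrable_bound)
      show "set_integrable lborel {1..} (\<lambda>u::real. C * D * u powr (- 2))"
        using has_integral_powr_to_inf[of "-2" 1]
        by (intro set_integrable_mult_right set_integrable_lborel_nonneg) auto
      have "g s u \<le> C * D * u powr (- 2)" if u: "1 \<le> u" for u
      proof -
        have u1: "1 \<le> u powr \<gamma>" using u gamma by (intro ge_one_powr_ge_zero) auto
        have "h u \<le> exp (- ((\<alpha> + \<rho>) * u powr \<gamma>)) * (1 / (\<rho> * u powr \<gamma>) + 2)"
          using h_le u by auto
        also have "\<dots> \<le> (C * u powr (- (s + 1))) * D"
          by (rule mult_mono) (use C u u1 rho_pos in \<open>auto simp: D_def field_simps\<close>)
        finally have "g s u \<le> (C * u powr (- (s + 1))) * D * u powr (s - 1)"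
          unfolding g_def by (intro mult_right_mono) auto
        also have "\<dots> = C * D * (u powr (- (s + 1)) * u powr (s - 1))" by simp
        also have "u powr (- (s + 1)) * u powr (s - 1) = u powr (- 2)"
          using u by (simp flip: powr_add)
        finally show ?thesis .
      qed
      then show "AE u in lborel. u \<in> {1..} \<longrightarrow> norm (g s u) \<le> norm (C * D * u powr (- 2))"
        using g_pos[of _ s] D C by (auto simp: abs_of_pos abs_mult)
    qed (simp add: set_borel_measurable_def)
  qed
  ultimately have "set_integrable lborel ({0<..1} \<union> {1..}) (g s)"
    by (rule set_integrable_Un) auto
  moreover have "{0<..1} \<union> {1..} = ({0<..} :: real set)" by auto
  ultimately show ?thesis by simp
qed

section \<open>The constant as a function of the exponent, with its head and tail integrals\<close>

definition k :: "real \<Rightarrow> real" where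
  "k s = (LINT t:{0<..}|lborel. g s t)"

lemma k_const_eq: "k_const \<alpha> \<rho> \<gamma> s = k s"
  by (simp add: k_const_def k_def g_def h_def)

lemma set_lebesgue_integral_g_pos:
  assumes "\<gamma> < s" "0 \<le> a" "a < b"
  shows "0 < (LINT u:{a<..<b}|lborel. g s u)"
proof -
  have int: "set_integrable lborel {a<..<b} (g s)"
    using assms by (intro set_integrable_subset[OF g_integrable]) auto
  have "(\<integral>\<^sup>+u\<in>{a<..<b}. ennreal (g s u) \<partial>lborel) \<noteq> 0"
  proof
    assume "(\<integral>\<^sup>+u\<in>{a<..<b}. ennreal (g s u) \<partial>lborel) = 0"
    then have "AE u in lborel. ennreal (g s u) * indicator {a<..<b} u = 0"
      by (subst (asm) nn_integral_0_iff_AE) auto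
    then have "AE u in lborel. u \<notin> {a<..<b}"
    proof (rule eventually_mono)
      fix u assume "ennreal (g s u) * indicator {a<..<b} u = 0"
      then show "u \<notin> {a<..<b}"
        using assms g_pos[of u s] by (auto split: split_indicator simp: ennreal_eq_0_iff)
    qed
    then have "emeasure lborel {a<..<b} = 0"
      by (subst (asm) AE_iff_measurable[where N = "{a<..<b}"]) auto
    then show False using assms by simp
  qed
  then show ?thesis
    using set_nn_integral_eq_set_lebesgue_integral[OF int] assms less_imp_le[OF g_pos, of _ s]
    by (simp add: ennreal_eq_0_iff not_le)
qed

lemma k_split:
  assumes "\<gamma> < s" "0 \<le> Y"
  shows "k s = (LINT u:{0<..Y}|lborel. g s u) + (LINT u:{Y<..}|lborel. g s u)"
proof -
  have "(LINT u:{0<..Y} \<union> {Y<..}|lborel. g s u) = (LINT u:{0<..Y}|lborel. g s u) + (LINT u:{Y<..}|lborel. g s u)"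
    by (intro set_integral_Un set_integrable_subset[OF g_integrable[OF assms(1)]]) (use assms in auto)
  moreover have "{0<..Y} \<union> {Y<..} = {0<..}" using assms by auto
  ultimately show ?thesis by (simp add: k_def)
qed

lemma g_integral_mono:
  assumes "\<gamma> < s" "A \<subseteq> B" "B \<subseteq> {0<..}" and [measurable]: "A \<in> sets borel" "B \<in> sets borel"
  shows "(LINT u:A|lborel. g s u) \<le> (LINT u:B|lborel. g s u)"
proof -
  have "set_integrable lborel A (g s)" "set_integrable lborel B (g s)"
    using assms by (auto intro!: set_integrable_subset[OF g_integrable])
  then show ?thesis unfolding set_lebesgue_integral_def set_integrable_def
    using assms(2,3) g_pos[of _ s]
    by (intro integral_mono) (auto split: split_indicator intro: less_imp_le)
qed

lemma tail_pos:
  assumes "\<gamma> < s" "0 \<le> Y" shows "0 < (LINT u:{Y<..}|lborel. g s u)"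
  using set_lebesgue_integral_g_pos[of s Y "Y + 1"] g_integral_mono[of s "{Y<..<Y + 1}" "{Y<..}"] assms
  by force

lemma head_pos:
  assumes "\<gamma> < s" "0 < Y" shows "0 < (LINT u:{0<..Y}|lborel. g s u)"
  using set_lebesgue_integral_g_pos[of s 0 Y] g_integral_mono[of s "{0<..<Y}" "{0<..Y}"] assms
  by force

lemma k_pos: "\<gamma> < s \<Longrightarrow> 0 < k s"
  using tail_pos[of s 0] by (simp add: k_def)

lemma head_small:
  assumes "\<gamma> < s" "0 < \<eta>"
  obtains r where "0 < r" "(LINT u:{0<..r}|lborel. g s u) < \<eta>"
proof -
  have "set_integrable lborel {0<..1} (g s)"
    by (rule set_integrable_subset[OF g_integrable[OF assms(1)]]) auto
  from set_integral_initial_small[OF this _ assms(2)] show thesis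
    using that by (auto simp: abs_less_iff)
qed

text \<open>Right continuity of \<open>k\<close>, needed for \<open>k (\<sigma> + e / p)\<close> as
  \<open>e\<close> tends to 0. The majorant is \<open>g s + g (s + C)\<close>: the first term
  dominates for \<open>u \<le> 1\<close>, the second for \<open>u > 1\<close>.\<close>

lemma k_tendsto:
  assumes "\<gamma> < s" "\<epsilon> \<longlonglongrightarrow> 0" "\<And>n. 0 \<le> \<epsilon> n" "\<And>n. \<epsilon> n \<le> C"
  shows "(\<lambda>n. k (s + \<epsilon> n)) \<longlonglongrightarrow> k s"
  unfolding k_def set_lebesgue_integral_def
proof (rule integral_dominated_convergence)
  have C: "0 \<le> C" using assms(3,4)[of 0] by simp
  show "integrable lborel (\<lambda>u. indicator {0<..} u *\<^sub>R g s u + indicator {0<..} u *\<^sub>R g (s + C) u)"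
    using g_integrable[of s] g_integrable[of "s + C"] assms(1) C by (auto simp: set_integrable_def)
  have "(\<lambda>n. indicator {0<..} u *\<^sub>R g (s + \<epsilon> n) u) \<longlonglongrightarrow> indicator {0<..} u *\<^sub>R g s u" for u
  proof (cases "0 < u")
    case True
    have "(\<lambda>n. h u * u powr (s + \<epsilon> n - 1)) \<longlonglongrightarrow> h u * u powr (s + 0 - 1)"
      by (intro tendsto_intros assms(2)) (use True in auto)
    then show ?thesis using True by (simp add: g_def)
  qed simp
  then show "AE u in lborel. (\<lambda>n. indicator {0<..} u *\<^sub>R g (s + \<epsilon> n) u) \<longlonglongrightarrow> indicator {0<..} u *\<^sub>R g s u"
    by simp
  have "g (s + \<epsilon> n) u \<le> g s u + g (s + C) u" if u: "0 < u" for u n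
  proof (cases "u \<le> 1")
    case True
    then have "g (s + \<epsilon> n) u \<le> g s u"
      unfolding g_def using u assms(3) h_pos[OF u] by (intro mult_left_mono powr_mono') auto
    then show ?thesis using g_pos[OF u, of "s + C"] by simp
  next
    case False
    then have "g (s + \<epsilon> n) u \<le> g (s + C) u"
      unfolding g_def using u assms(4) h_pos[OF u] by (intro mult_left_mono powr_mono) auto
    then show ?thesis using g_pos[OF u, of s] by simp
  qed
  then show "AE u in lborel. norm (indicator {0<..} u *\<^sub>R g (s + \<epsilon> n) u)
      \<le> indicator {0<..} u *\<^sub>R g s u + indicator {0<..} u *\<^sub>R g (s + C) u" for n
    using g_pos[of _ "s + \<epsilon> n"] by (auto split: split_indicator intro: less_imp_le simp: abs_of_pos)
qed auto

text \<open>Cutting at the midpoint makes the rectangle bound strict: on the right half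
  \<open>g s\<close> is at most \<open>g s m\<close>, which is below \<open>g s a\<close>.\<close>

lemma set_nn_integral_g_le:
  assumes "0 < a" "a < b" "s \<le> 1"
  shows "(\<integral>\<^sup>+u\<in>{a<..b}. ennreal (g s u) \<partial>lborel) < ennreal (g s a * (b - a))"
proof -
  define m where "m = (a + b) / 2"
  have m: "a < m" "m < b" "0 < m" using assms by (auto simp: m_def)
  have le: "g s u \<le> g s v" if "0 < v" "v \<le> u" for u v
    using g_less[OF that(1), of u s] that assms(3) by (cases "v = u") auto
  have "(\<integral>\<^sup>+u\<in>{a<..b}. ennreal (g s u) \<partial>lborel) \<le>
      (\<integral>\<^sup>+u. ennreal (g s a) * indicator {a<..m} u + ennreal (g s m) * indicator {m<..b} u \<partial>lborel)"
    using m assms by (intro nn_integral_mono) (auto split: split_indicator intro!: ennreal_leI le)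
  also have "\<dots> = ennreal (g s a * (m - a) + g s m * (b - m))"
    using m assms g_pos[of a s] g_pos[of m s]
    by (simp add: nn_integral_add nn_integral_cmult_indicator ennreal_mult[symmetric] ennreal_plus[symmetric] del: ennreal_plus)
  also have "\<dots> < ennreal (g s a * (b - a))"
  proof -
    have "g s m * (b - m) < g s a * (b - m)"
      using g_less[OF assms(1) m(1) assms(3)] m by (intro mult_strict_right_mono) auto
    then have "g s a * (m - a) + g s m * (b - m) < g s a * (b - a)"
      by (simp add: algebra_simps)
    moreover have "0 \<le> g s a * (m - a) + g s m * (b - m)"
      using m assms g_pos[of a s] g_pos[of m s] by simp
    ultimately show ?thesis by (simp add: ennreal_less_iff)
  qed
  finally show ?thesis .
qed

text \<open>The intervals \<open>{t n<..t (Suc n)}\<close> partition the tail, and for a decreasing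
  integrand the rectangles at left endpoints exceed the integral on each of them.\<close>

lemma tail_less_sum:
  assumes s: "\<gamma> < s" "s \<le> 1" and t: "strict_mono t" "0 < t 0" "filterlim t at_top sequentially"
  shows "ennreal (LINT u:{t 0<..}|lborel. g s u) < (\<Sum>n. ennreal (g s (t n) * (t (Suc n) - t n)))"
proof -
  define J where "J n = (\<integral>\<^sup>+u\<in>{t n<..t (Suc n)}. ennreal (g s u) \<partial>lborel)" for n
  have tpos: "0 < t n" for n using t(2) strict_mono_less_eq[OF t(1), of 0 n] by simp
  have un: "{t 0<..} = (\<Union>n. {t n<..t (Suc n)})"
  proof (intro set_eqI iffI)
    fix u assume u: "u \<in> {t 0<..}"
    have "\<exists>n. u \<le> t n"
      using t(3) by (force simp: filterlim_at_top eventually_sequentially)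
    define N where "N = (LEAST n. u \<le> t n)"
    have N: "u \<le> t N" unfolding N_def using \<open>\<exists>n. u \<le> t n\<close> by (rule LeastI_ex)
    have "N \<noteq> 0" using N u by (intro notI) auto
    then obtain n where n: "N = Suc n" by (cases N) auto
    then have "\<not> u \<le> t n" unfolding N_def by (metis lessI not_less_Least)
    then show "u \<in> (\<Union>n. {t n<..t (Suc n)})" using N n not_le by (auto intro!: exI[of _ n])
  next
    fix u assume "u \<in> (\<Union>n. {t n<..t (Suc n)})"
    then obtain n where "t n < u" by auto
    then show "u \<in> {t 0<..}" using strict_mono_less_eq[OF t(1), of 0 n] by simp
  qed
  have disj: "disjoint_family (\<lambda>n. {t n<..t (Suc n)})"
    unfolding disjoint_family_on_def
  proof (intro ballI impI)
    have "{t m<..t (Suc m)} \<inter> {t n<..t (Suc n)} = {}" if "m < n" for m n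
      using that strict_mono_less_eq[OF t(1), of "Suc m" n] by auto
    then show "m \<in> UNIV \<Longrightarrow> n \<in> UNIV \<Longrightarrow> m \<noteq> n \<Longrightarrow> {t m<..t (Suc m)} \<inter> {t n<..t (Suc n)} = {}" for m n
      by (metis Int_commute linorder_neqE_nat)
  qed
  have tail: "ennreal (LINT u:{t 0<..}|lborel. g s u) = (\<integral>\<^sup>+u\<in>{t 0<..}. ennreal (g s u) \<partial>lborel)"
  proof (rule set_nn_integral_eq_set_lebesgue_integral[symmetric])
    show "set_integrable lborel {t 0<..} (g s)"
      by (rule set_integrable_subset[OF g_integrable[OF s(1)]]) (use t(2) in auto)
    show "0 \<le> g s u" if "u \<in> {t 0<..}" for u
      using that t(2) g_pos[of u s] by simp
  qed
  also have "\<dots> = (\<Sum>n. J n)"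
    unfolding un J_def by (rule nn_integral_disjoint_family) (use disj in auto)
  finally have sumJ: "ennreal (LINT u:{t 0<..}|lborel. g s u) = (\<Sum>n. J n)" .
  have less: "J n < ennreal (g s (t n) * (t (Suc n) - t n))" for n
    unfolding J_def using tpos s(2) strict_monoD[OF t(1), of n "Suc n"]
    by (intro set_nn_integral_g_le) auto
  \<comment> \<open>Over the counting measure, strict termwise inequality passes to the sums because
    the smaller sum, being the tail integral, is finite.\<close>
  have "(\<integral>\<^sup>+n. J n \<partial>count_space UNIV) < (\<integral>\<^sup>+n. ennreal (g s (t n) * (t (Suc n) - t n)) \<partial>count_space UNIV)"
  proof (rule nn_integral_less)
    show "(\<integral>\<^sup>+n. J n \<partial>count_space UNIV) \<noteq> \<infinity>"
      by (simp add: nn_integral_count_space_nat flip: sumJ)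
    show "AE n in count_space UNIV. J n \<le> ennreal (g s (t n) * (t (Suc n) - t n))"
      using less by (simp add: AE_count_space less_imp_le)
    show "\<not> (AE n in count_space UNIV. ennreal (g s (t n) * (t (Suc n) - t n)) \<le> J n)"
      using less by (simp add: AE_count_space not_le)
  qed simp_all
  then show ?thesis by (simp add: nn_integral_count_space_nat sumJ)
qed

text \<open>Substitution \<open>v = c * u\<close>, later with \<open>c = s n\<close>: the factor
  \<open>c powr (1 - s)\<close> and the Jacobian \<open>1 / c\<close> combine to
  \<open>c powr (- s)\<close>.\<close>

lemma g_scale_integral:
  assumes "\<gamma> < s" "0 < c"
  shows "set_integrable lborel {0<..} (\<lambda>u. h (u * c) * u powr (s - 1))"
    and "(LINT u:{0<..}|lborel. h (u * c) * u powr (s - 1)) = k s * c powr (- s)"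
proof -
  define G where "G u = indicator {0<..} u *\<^sub>R g s u" for u
  have G: "integrable lborel G"
    using g_integrable[OF assms(1)] unfolding set_integrable_def G_def .
  \<comment> \<open>\<open>G\<close> carries the indicator, which is invariant under scaling by
    \<open>c > 0\<close>; \<open>0 + c * u\<close> is the shape that the affine substitution rule
    expects.\<close>
  have eq: "indicator {0<..} u *\<^sub>R (h (u * c) * u powr (s - 1)) = c powr (1 - s) * G (0 + c * u)" for u
  proof (cases "0 < u")
    case True
    have "u powr (s - 1) = c powr (1 - s) * (c * u) powr (s - 1)"
      using True assms by (simp add: powr_mult mult.assoc[symmetric] powr_add[symmetric])
    then show ?thesis using True assms by (simp add: G_def g_def mult.commute)
  next
    case False
    then show ?thesis using assms by (simp add: G_def zero_less_mult_iff)
  qed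
  show "set_integrable lborel {0<..} (\<lambda>u. h (u * c) * u powr (s - 1))"
    unfolding set_integrable_def eq using assms(2)
    by (intro integrable_mult_right lborel_integrable_real_affine[OF G]) auto
  have "k s = \<bar>c\<bar> *\<^sub>R (LINT u|lborel. G (0 + c * u))"
    unfolding k_def set_lebesgue_integral_def G_def[symmetric]
    using assms(2) by (intro lborel_integral_real_affine) auto
  then have "(LINT u|lborel. G (0 + c * u)) = k s / c" using assms by (simp add: field_simps)
  then show "(LINT u:{0<..}|lborel. h (u * c) * u powr (s - 1)) = k s * c powr (- s)"
    unfolding set_lebesgue_integral_def eq using assms
    by (simp add: powr_diff powr_minus field_simps)
qed

end

section \<open>The change of variables\<close>

locale half_line_density =
  fixes \<mu> :: "real \<Rightarrow> real" and \<delta> :: real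
  assumes mu_pos: "\<And>x. x > 0 \<Longrightarrow> 0 < \<mu> x"
    and mu_cont: "continuous_on {0<..} \<mu>"
    and mu_int: "\<And>x. x > 0 \<Longrightarrow> set_integrable lborel {0<..x} \<mu>"
    and delta: "\<delta> \<in> {-1, 1}"
    and U_inf: "filterlim (U \<mu>) at_top at_top"
begin

abbreviation Y :: "real \<Rightarrow> real" where "Y x \<equiv> U \<mu> x powr \<delta>"

text \<open>The base point \<open>a > 0\<close> keeps away from 0, where \<open>\<mu>\<close> may be
  unbounded, so that the fundamental theorem of calculus applies on the compact interval.\<close>

lemma U_diff:
  assumes "0 < a" "a \<le> y"
  shows "U \<mu> y = U \<mu> a + integral {a..y} \<mu>"
proof -
  have int: "set_integrable lborel {a<..y} \<mu>"
    using assms by (intro set_integrable_subset[OF mu_int[of y]]) auto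
  have "(LINT t:{0<..a} \<union> {a<..y}|lborel. \<mu> t) = (LINT t:{0<..a}|lborel. \<mu> t) + (LINT t:{a<..y}|lborel. \<mu> t)"
    by (rule set_integral_Un[OF _ mu_int[OF assms(1)] int]) auto
  moreover have "{0<..a} \<union> {a<..y} = {0<..y}" using assms by auto
  ultimately have "U \<mu> y = U \<mu> a + (LINT t:{a<..y}|lborel. \<mu> t)"
    by (simp only: U_def)
  also have "(LINT t:{a<..y}|lborel. \<mu> t) = integral {a<..y} \<mu>"
    by (rule set_borel_integral_eq_integral(2)[OF int])
  also have "\<dots> = integral {a..y} \<mu>"
  proof (rule integral_subset_negligible)
    have "{a..y} - {a<..y} \<subseteq> {a}" by auto
    then show "negligible ({a..y} - {a<..y})" by (rule negligible_subset[rotated]) simp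
  qed auto
  finally show ?thesis .
qed

lemma U_deriv: "0 < x \<Longrightarrow> (U \<mu> has_real_derivative \<mu> x) (at x)"
proof -
  assume x: "0 < x"
  have "((\<lambda>y. integral {x/2..y} \<mu>) has_real_derivative \<mu> x) (at x within {x/2..2*x})"
    by (rule integral_has_real_derivative) (use x in \<open>auto intro: continuous_on_subset[OF mu_cont]\<close>)
  moreover have "at x within {x/2..2*x} = at x"
    by (rule at_within_interior) (use x in simp)
  ultimately have "((\<lambda>y. U \<mu> (x/2) + integral {x/2..y} \<mu>) has_real_derivative \<mu> x) (at x)"
    by (auto intro!: derivative_eq_intros)
  then show ?thesis
  proof (rule has_field_derivative_transform_within_open[of _ _ _ "{x/2<..}"])
    fix y assume "y \<in> {x/2<..}"
    then show "U \<mu> (x/2) + integral {x/2..y} \<mu> = U \<mu> y"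
      using U_diff[of "x/2" y] x by simp
  qed (use x in auto)
qed

lemma U_less:
  assumes "0 < x" "x < y" shows "U \<mu> x < U \<mu> y"
proof (rule DERIV_pos_imp_increasing[OF assms(2)])
  fix z assume "x \<le> z"
  then have "0 < z" using assms by simp
  then show "\<exists>D. (U \<mu> has_real_derivative D) (at z) \<and> 0 < D"
    using U_deriv mu_pos by blast
qed

lemma U_nonneg: "0 \<le> U \<mu> x"
  unfolding U_def set_lebesgue_integral_def
  using mu_pos by (intro integral_nonneg_AE AE_I2) (auto split: split_indicator intro: less_imp_le)

lemma U_pos: "0 < x \<Longrightarrow> 0 < U \<mu> x"
  using U_less[of "x/2" x] U_nonneg[of "x/2"] by simp

text \<open>Intermediate values between small values near 0, where the integral of
  \<open>\<mu>\<close> is small, and large values from \<open>U_inf\<close>.\<close>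

lemma U_image: "U \<mu> ` {0<..} = {0<..}"
proof (intro equalityI subsetI)
  fix y :: real assume y: "y \<in> {0<..}"
  obtain a where a: "0 < a" "U \<mu> a < y"
    using set_integral_initial_small[OF mu_int[of 1], of y] y
    by (auto simp: U_def abs_less_iff)
  have "eventually (\<lambda>x. y \<le> U \<mu> x \<and> a \<le> x) at_top"
    using U_inf[unfolded filterlim_at_top] by (auto intro: eventually_conj eventually_ge_at_top)
  then obtain b where b: "y \<le> U \<mu> b" "a \<le> b"
    by (auto simp: eventually_at_top_linorder)
  have "\<exists>x. a \<le> x \<and> x \<le> b \<and> U \<mu> x = y"
    by (rule IVT) (use a b in \<open>auto intro!: DERIV_isCont[OF U_deriv]\<close>)
  then show "y \<in> U \<mu> ` {0<..}" using a by auto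
qed (auto intro: U_pos)

lemma Y_pos: "0 < x \<Longrightarrow> 0 < Y x"
  using U_pos[of x] by simp

lemma Y_deriv: "0 < x \<Longrightarrow> (Y has_real_derivative \<delta> * (U \<mu> x powr (\<delta> - 1) * \<mu> x)) (at x)"
  using DERIV_powr[OF U_deriv U_pos DERIV_const[of \<delta>], of x] U_pos[of x]
  by (simp add: powr_diff field_simps)

text \<open>Since \<open>\<delta> * \<delta> = 1\<close>, raising to the power
  \<open>\<delta>\<close> is its own inverse. Injectivity of \<open>Y\<close> follows for both signs
  at once.\<close>

lemma Y_delta: "Y x powr \<delta> = U \<mu> x"
  using delta U_nonneg[of x] by (auto simp: powr_powr)

lemma Y_inj: "inj_on Y {0<..}"
proof (rule inj_onI)
  fix x y assume xy: "x \<in> {0<..}" "y \<in> {0<..}" "Y x = Y y"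
  then have "U \<mu> x = U \<mu> y" by (metis Y_delta)
  then show "x = y"
    using xy U_less[of x y] U_less[of y x] by (cases x y rule: linorder_cases) auto
qed

lemma Y_image: "Y ` {0<..} = {0<..}"
proof (intro equalityI subsetI)
  fix y :: real assume y: "y \<in> {0<..}"
  then have "y powr \<delta> \<in> U \<mu> ` {0<..}" using U_image by simp
  then obtain x where x: "0 < x" "U \<mu> x = y powr \<delta>" by auto
  have "y = Y x" using y delta by (auto simp: x powr_powr)
  then show "y \<in> Y ` {0<..}" using x(1) by (intro image_eqI[where x = x]) simp_all
next
  fix y assume "y \<in> Y ` {0<..}"
  then show "y \<in> {0<..}" using Y_pos by blast
qed

text \<open>The change of variables rule takes the absolute value of the derivative, so it covers
  the decreasing case \<open>\<delta> = -1\<close> as well; \<open>\<bar>\<delta>\<bar> = 1\<close>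
  leaves the Jacobian \<open>U \<mu> x powr (\<delta> - 1) * \<mu> x\<close>.\<close>

lemma nn_integral_substitution_Y:
  assumes F: "set_integrable lborel {0<..} F" "\<And>u. 0 < u \<Longrightarrow> 0 \<le> F u"
  shows "(\<integral>\<^sup>+x\<in>{0<..}. ennreal (F (Y x) * (U \<mu> x powr (\<delta> - 1) * \<mu> x)) \<partial>lebesgue) =
    ennreal (LINT u:{0<..}|lborel. F u)"
proof -
  let ?D = "\<lambda>x. \<delta> * (U \<mu> x powr (\<delta> - 1) * \<mu> x)"
  have "integrable lborel (\<lambda>u. indicator {0<..} u *\<^sub>R F u)"
    using F(1) unfolding set_integrable_def .
  then have abs: "F absolutely_integrable_on {0<..}"
    unfolding set_integrable_def by (subst integrable_completion) auto
  have int: "integral {0<..} F = (LINT u:{0<..}|lborel. F u)"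
    using set_borel_integral_eq_integral(2)[OF F(1)] by simp
  have *: "(\<lambda>x. \<bar>?D x\<bar> * F (Y x)) absolutely_integrable_on {0<..} \<and>
      integral {0<..} (\<lambda>x. \<bar>?D x\<bar> * F (Y x)) = (LINT u:{0<..}|lborel. F u)"
  proof (subst has_absolute_integral_change_of_variables_1'[OF _ _ Y_inj])
    show "(Y has_real_derivative ?D x) (at x within {0<..})" if "x \<in> {0<..}" for x
      using that by (intro has_field_derivative_at_within[OF Y_deriv]) simp
    show "F absolutely_integrable_on Y ` {0<..} \<and> integral (Y ` {0<..}) F = (LINT u:{0<..}|lborel. F u)"
      using abs int by (simp only: Y_image)
  qed simp
  have "(\<integral>\<^sup>+x\<in>{0<..}. ennreal (F (Y x) * (U \<mu> x powr (\<delta> - 1) * \<mu> x)) \<partial>lebesgue) =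
      (\<integral>\<^sup>+x\<in>{0<..}. ennreal (\<bar>?D x\<bar> * F (Y x)) \<partial>lebesgue)"
    using delta by (intro set_nn_integral_cong refl) (auto simp: abs_mult mult.commute abs_of_pos mu_pos)
  also have "\<dots> = ennreal (LINT x:{0<..}|lebesgue. \<bar>?D x\<bar> * F (Y x))"
    by (rule set_nn_integral_eq_set_lebesgue_integral) (use * F(2)[OF Y_pos] in simp_all)
  also have "(LINT x:{0<..}|lebesgue. \<bar>?D x\<bar> * F (Y x)) = (LINT u:{0<..}|lborel. F u)"
    using * set_lebesgue_integral_eq_integral(2) by metis
  finally show ?thesis .
qed

lemma measurable_U [measurable]: "U \<mu> \<in> borel_measurable (lebesgue_on {0<..})"
  by (intro continuous_imp_measurable_on_sets_lebesgue continuous_at_imp_continuous_on ballI DERIV_isCont[OF U_deriv]) auto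

lemma measurable_mu [measurable]: "\<mu> \<in> borel_measurable (lebesgue_on {0<..})"
  by (intro continuous_imp_measurable_on_sets_lebesgue mu_cont) auto

end

section \<open>Weights and norms\<close>

locale half_discrete = csch_kernel \<alpha> \<rho> \<gamma> + half_line_density \<mu> \<delta>
  for \<alpha> \<rho> \<gamma> :: real and \<mu> :: "real \<Rightarrow> real" and \<delta> :: real +
  fixes \<sigma> \<beta> p q :: real and \<nu> :: "nat \<Rightarrow> real"
  assumes nu_pos: "\<And>n. n \<ge> 1 \<Longrightarrow> 0 < \<nu> n"
    and nu_dec: "\<And>n. n \<ge> 1 \<Longrightarrow> \<nu> (n + 1) \<le> \<nu> n"
    and beta: "\<beta> \<le> \<nu> 1 / 2"
    and gamma_sigma: "\<gamma> < \<sigma>" and sigma: "\<sigma> \<le> 1"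
    and V_inf: "filterlim (V \<nu>) at_top sequentially"
    and p: "0 < p" "p < 1"
    and pq: "1 / p + 1 / q = 1"
begin

lemma q_neg: "q < 0"
proof -
  have "1 < 1 / p" using p by simp
  then have "1 / q < 0" using pq by linarith
  then show ?thesis by (simp add: divide_less_0_iff)
qed

text \<open>The first part is the division-free form of conjugacy on which \<open>algebra\<close>
  relies when exponents are compared.\<close>

lemma q_eq: "p * q = p + q" "1 / q = (p - 1) / p"
proof -
  show "p * q = p + q" using pq p q_neg by (simp add: field_simps)
  then show "1 / q = (p - 1) / p"
    using p q_neg by (simp add: field_simps)
qed

text \<open>Indices are shifted by one: \<open>s n\<close> is \<open>V_(n+1) - \<beta>\<close> in the notation of the paper.\<close>

definition s :: "nat \<Rightarrow> real" where "s n = V \<nu> (Suc n) - \<beta>"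

text \<open>The gap after the node of index \<open>N = Suc n\<close> is
  \<open>\<nu> (N + 1)\<close>, so weights with this factor turn series into Riemann sums over the
  nodes \<open>s n\<close>.\<close>

lemma s_Suc: "s (Suc n) = s n + \<nu> (n + 2)"
  by (simp add: s_def V_def)

lemma s_strict_mono: "strict_mono s"
  by (rule strict_monoI_Suc) (simp add: s_Suc nu_pos)

text \<open>The bound on \<open>\<beta>\<close> gives \<open>s 0 \<ge> \<nu> 1 / 2\<close>, and
  \<open>s\<close> increases.\<close>

lemma s_pos: "0 < s n"
proof -
  have "0 < s 0" using beta nu_pos[of 1] by (simp add: s_def V_def)
  then show ?thesis using strict_mono_less_eq[OF s_strict_mono, of 0 n] by simp
qed

lemma s_at_top: "filterlim s at_top sequentially"
proof -
  have "filterlim (\<lambda>n. - \<beta> + V \<nu> (Suc n)) at_top sequentially"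
    by (intro filterlim_tendsto_add_at_top[OF tendsto_const] filterlim_compose[OF V_inf filterlim_Suc])
  then show ?thesis by (simp add: s_def[abs_def])
qed

abbreviation M :: "real measure" where "M \<equiv> lebesgue_on {0<..}"

lemma nn_integral_M: "(\<integral>\<^sup>+x\<in>{0<..}. F x \<partial>lebesgue) = (\<integral>\<^sup>+x. F x \<partial>M)"
  by (simp add: nn_integral_restrict_space)

lemma AE_M_I: "(\<And>x. 0 < x \<Longrightarrow> P x) \<Longrightarrow> AE x in M. P x"
  by (rule AE_I2) (auto simp: space_restrict_space)

lemma nn_integral_M_cong: "(\<And>x. 0 < x \<Longrightarrow> F x = G x) \<Longrightarrow> (\<integral>\<^sup>+x. F x \<partial>M) = (\<integral>\<^sup>+x. G x \<partial>M)"
  by (rule nn_integral_cong) (simp add: space_restrict_space)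

text \<open>Turns a strict inequality at every point of the half-line into a strict inequality of
  integrals.\<close>

lemma M_not_AE_False: "\<not> (AE x in M. False)"
proof
  assume "AE x in M. False"
  then have "emeasure M (space M) = 0"
    by (simp add: eventually_False ae_filter_eq_bot_iff)
  then have "emeasure lebesgue ({0<..} :: real set) = 0"
    by (simp add: space_restrict_space emeasure_restrict_space)
  moreover have "emeasure lebesgue {0<..<1::real} \<le> emeasure lebesgue ({0<..} :: real set)"
    by (rule emeasure_mono) auto
  ultimately show False by simp
qed

section \<open>The kernel and its two weights\<close>

abbreviation K :: "real \<Rightarrow> nat \<Rightarrow> real" where "K x n \<equiv> h (Y x * s n)"

lemma K_pos: "0 < x \<Longrightarrow> 0 < K x n"
  by (intro h_pos mult_pos_pos Y_pos s_pos)

lemma kernel_eq: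
  assumes "0 < x" shows "kernel \<alpha> \<rho> \<gamma> \<beta> \<delta> \<mu> \<nu> x (Suc n) = K x n"
proof -
  have "(Y x * s n) powr \<gamma> = U \<mu> x powr (\<delta> * \<gamma>) * s n powr \<gamma>"
    using Y_pos[OF assms] s_pos[of n] by (simp add: powr_mult powr_powr)
  then show ?thesis
    unfolding kernel_def h_def by (simp add: mult.assoc s_def[symmetric])
qed

lemma measurable_K [measurable]: "(\<lambda>x. K x n) \<in> borel_measurable M"
  by measurable

text \<open>Rests on \<open>U^(\<delta> t - 1) = Y^(t - 1) * U^(\<delta> - 1)\<close>, the last
  factor being part of the Jacobian. The case \<open>t = \<sigma>\<close> serves the inequalities,
  \<open>t = \<sigma> + e / p\<close> the test functions.\<close>

lemma weight_integral:
  assumes "\<gamma> < t"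
  shows "(\<integral>\<^sup>+x. ennreal (K x n * (\<mu> x * U \<mu> x powr (\<delta> * t - 1))) \<partial>M) = ennreal (k t * s n powr (- t))"
proof -
  have "(\<integral>\<^sup>+x. ennreal (K x n * (\<mu> x * U \<mu> x powr (\<delta> * t - 1))) \<partial>M) =
      (\<integral>\<^sup>+x\<in>{0<..}. ennreal (h (Y x * s n) * Y x powr (t - 1) * (U \<mu> x powr (\<delta> - 1) * \<mu> x)) \<partial>lebesgue)"
    unfolding nn_integral_M
  proof (rule nn_integral_M_cong)
    fix x :: real assume "0 < x"
    have "Y x powr (t - 1) * U \<mu> x powr (\<delta> - 1) = U \<mu> x powr (\<delta> * t - 1)"
      by (simp add: powr_powr powr_add[symmetric] algebra_simps)
    then show "ennreal (K x n * (\<mu> x * U \<mu> x powr (\<delta> * t - 1))) =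
        ennreal (h (Y x * s n) * Y x powr (t - 1) * (U \<mu> x powr (\<delta> - 1) * \<mu> x))"
      by (metis mult.assoc mult.commute)
  qed
  also have "\<dots> = ennreal (k t * s n powr (- t))"
    using h_pos s_pos
    by (subst nn_integral_substitution_Y[OF g_scale_integral(1)[OF assms s_pos]])
      (simp_all add: g_scale_integral(2)[OF assms s_pos] less_imp_le)
  finally show ?thesis .
qed

abbreviation \<theta> :: "real \<Rightarrow> real" where "\<theta> \<equiv> theta \<alpha> \<rho> \<gamma> \<sigma> \<beta> \<delta> \<mu> \<nu>"

lemma k_sigma_pos: "0 < k \<sigma>"
  by (rule k_pos[OF gamma_sigma])

lemma theta_eq: "\<theta> x = (LINT u:{0<..Y x * s 0}|lborel. g \<sigma> u) / k \<sigma>"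
  unfolding theta_def k_const_eq s_def V_def g_def h_def by simp

lemma one_minus_theta:
  assumes "0 < x" shows "k \<sigma> * (1 - \<theta> x) = (LINT u:{Y x * s 0<..}|lborel. g \<sigma> u)"
  using k_split[OF gamma_sigma, of "Y x * s 0"] Y_pos[OF assms] s_pos[of 0] k_sigma_pos
  by (simp add: theta_eq field_simps)

lemma theta_less_1: "0 < x \<Longrightarrow> \<theta> x < 1"
  using one_minus_theta[of x] tail_pos[OF gamma_sigma, of "Y x * s 0"] Y_pos[of x] s_pos[of 0] k_sigma_pos
  by (metis diff_gt_0_iff_gt less_imp_le mult_nonneg_nonneg zero_less_mult_pos)

lemma theta_nonneg: "0 < x \<Longrightarrow> 0 \<le> \<theta> x"
  unfolding theta_eq using head_pos[OF gamma_sigma, of "Y x * s 0"] Y_pos[of x] s_pos[of 0] k_sigma_pos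
  by simp

text \<open>The head integral is monotone in its upper limit, hence Borel; \<open>\<theta>\<close>
  composes it with a multiple of \<open>Y\<close>.\<close>

lemma measurable_theta [measurable]: "\<theta> \<in> borel_measurable M"
proof -
  have [measurable]: "(\<lambda>y. LINT u:{0<..y}|lborel. g \<sigma> u) \<in> borel_measurable borel"
    by (intro borel_measurable_mono monoI g_integral_mono gamma_sigma) auto
  show ?thesis unfolding theta_eq[abs_def] by measurable
qed

text \<open>Rectangles over the nodes \<open>Y x * s n\<close>; each of them contains the factor
  \<open>Y x powr \<sigma>\<close>, which is finally moved to the other side.\<close>

lemma weight_sum:
  assumes x: "0 < x"
  shows "ennreal (k \<sigma> * (1 - \<theta> x) * Y x powr (- \<sigma>)) < (\<Sum>n. ennreal (K x n * (\<nu> (n + 2) * s n powr (\<sigma> - 1))))"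
proof -
  let ?t = "\<lambda>n. Y x * s n"
  have y: "0 < Y x" by (rule Y_pos[OF x])
  have "ennreal (LINT u:{?t 0<..}|lborel. g \<sigma> u) < (\<Sum>n. ennreal (g \<sigma> (?t n) * (?t (Suc n) - ?t n)))"
  proof (rule tail_less_sum[OF gamma_sigma sigma])
    show "strict_mono ?t"
      using y strict_monoD[OF s_strict_mono] by (intro strict_monoI) (simp add: mult_strict_left_mono)
    show "filterlim ?t at_top sequentially"
      by (rule filterlim_tendsto_pos_mult_at_top[OF tendsto_const y s_at_top])
  qed (use y s_pos in simp)
  also have "(\<lambda>n. g \<sigma> (?t n) * (?t (Suc n) - ?t n)) =
      (\<lambda>n. Y x powr \<sigma> * (K x n * (\<nu> (n + 2) * s n powr (\<sigma> - 1))))"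
  proof
    fix n
    have "Y x powr (\<sigma> - 1) * Y x = Y x powr \<sigma>"
      using powr_mult_base[of "Y x" "\<sigma> - 1"] y by (simp add: mult.commute)
    then show "g \<sigma> (?t n) * (?t (Suc n) - ?t n) = Y x powr \<sigma> * (K x n * (\<nu> (n + 2) * s n powr (\<sigma> - 1)))"
      using y s_pos[of n] by (simp add: g_def powr_mult s_Suc algebra_simps)
  qed
  finally have "ennreal (k \<sigma> * (1 - \<theta> x)) <
      (\<Sum>n. ennreal (Y x powr \<sigma>) * ennreal (K x n * (\<nu> (n + 2) * s n powr (\<sigma> - 1))))"
    by (simp add: one_minus_theta[OF x] ennreal_mult')
  then have "ennreal (k \<sigma> * (1 - \<theta> x)) <
      ennreal (Y x powr \<sigma>) * (\<Sum>n. ennreal (K x n * (\<nu> (n + 2) * s n powr (\<sigma> - 1))))"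
    by (simp add: ennreal_suminf_cmult)
  then have "ennreal (Y x powr (- \<sigma>)) * ennreal (k \<sigma> * (1 - \<theta> x)) <
      ennreal (Y x powr (- \<sigma>)) * (ennreal (Y x powr \<sigma>) * (\<Sum>n. ennreal (K x n * (\<nu> (n + 2) * s n powr (\<sigma> - 1)))))"
    using y by (intro ennreal_mult_strict_left_mono) auto
  moreover have "ennreal (Y x powr (- \<sigma>)) * ennreal (Y x powr \<sigma>) = 1"
    using y by (simp add: ennreal_mult[symmetric] powr_add[symmetric])
  moreover have "ennreal (Y x powr (- \<sigma>)) * ennreal (k \<sigma> * (1 - \<theta> x)) = ennreal (k \<sigma> * (1 - \<theta> x) * Y x powr (- \<sigma>))"
    using k_sigma_pos theta_less_1[OF x] by (simp add: ennreal_mult[symmetric] mult.commute)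
  ultimately show ?thesis by (simp add: mult.assoc[symmetric])
qed

section \<open>The weights of the norms, and admissibility in terms of the expressions under the
  roots\<close>

abbreviation \<Phi> :: "real \<Rightarrow> real" where "\<Phi> \<equiv> Phi p \<sigma> \<delta> \<mu>"
abbreviation \<Phi>' :: "real \<Rightarrow> real" where "\<Phi>' \<equiv> Phi_tilde p \<alpha> \<rho> \<gamma> \<sigma> \<beta> \<delta> \<mu> \<nu>"
abbreviation \<Psi> :: "nat \<Rightarrow> real" where "\<Psi> \<equiv> Psi q \<sigma> \<beta> \<nu>"

lemma Phi_eq: "0 < x \<Longrightarrow> \<Phi> x = U \<mu> x powr (p * (1 - \<delta> * \<sigma>) - 1) * \<mu> x powr (1 - p)"
  by (simp add: Phi_def powr_diff mu_pos field_simps)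

lemma Phi_pos: "0 < x \<Longrightarrow> 0 < \<Phi> x"
  using U_pos[of x] mu_pos[of x] by (simp add: Phi_eq)

lemma Phi'_pos: "0 < x \<Longrightarrow> 0 < \<Phi>' x"
  using Phi_pos[of x] theta_less_1[of x] by (simp add: Phi_tilde_def)

lemma Phi'_le: "0 < x \<Longrightarrow> \<Phi>' x \<le> \<Phi> x"
  using Phi_pos[of x] theta_nonneg[of x] by (simp add: Phi_tilde_def algebra_simps)

lemma Psi_eq: "\<Psi> (Suc n) = s n powr (q * (1 - \<sigma>) - 1) * \<nu> (n + 2) powr (1 - q)"
  using nu_pos[of "n + 2"] by (simp add: Psi_def s_def powr_diff field_simps)

lemma Psi_pos: "0 < \<Psi> (Suc n)"
  using s_pos[of n] nu_pos[of "n + 2"] by (simp add: Psi_eq)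

lemma measurable_Phi [measurable]: "\<Phi> \<in> borel_measurable M"
  unfolding Phi_def[abs_def] by measurable

lemma measurable_Phi' [measurable]: "\<Phi>' \<in> borel_measurable M"
  unfolding Phi_tilde_def[abs_def] by measurable

definition norm_int :: "(real \<Rightarrow> real) \<Rightarrow> (real \<Rightarrow> real) \<Rightarrow> ennreal" where
  "norm_int w f = (\<integral>\<^sup>+x. ennreal (w x) * epowr (ennreal (f x)) p \<partial>M)"

definition norm_sum :: "(nat \<Rightarrow> real) \<Rightarrow> ennreal" where
  "norm_sum a = (\<Sum>n. ennreal (\<Psi> (Suc n)) * epowr (ennreal (a (Suc n))) q)"

lemma norm_fun_eq: "norm_fun p w f = epowr (norm_int w f) (1 / p)"
  by (simp add: norm_fun_def norm_int_def nn_integral_M)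

lemma norm_seq_eq: "norm_seq q \<Psi> a = epowr (norm_sum a) (1 / q)"
  by (simp add: norm_seq_def norm_sum_def)

text \<open>The factor \<open>1 - \<theta> x\<close> is positive throughout the half-line, so both
  weighted integrals vanish for the same functions, those that are zero almost everywhere.\<close>

lemma norm_int_Phi'_pos:
  assumes [measurable]: "f \<in> borel_measurable M" and "0 < norm_int \<Phi> f"
  shows "0 < norm_int \<Phi>' f" and "\<not> (AE x in M. f x \<le> 0)"
proof -
  show *: "\<not> (AE x in M. f x \<le> 0)"
  proof
    assume "AE x in M. f x \<le> 0"
    then have "AE x in M. ennreal (\<Phi> x) * epowr (ennreal (f x)) p = 0"
      by (rule eventually_mono) (use p in \<open>simp add: ennreal_neg epowr_0\<close>)
    then have "norm_int \<Phi> f = 0"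
      unfolding norm_int_def by (subst nn_integral_0_iff_AE) auto
    then show False using assms(2) by simp
  qed
  show "0 < norm_int \<Phi>' f"
  proof (rule ccontr)
    assume "\<not> 0 < norm_int \<Phi>' f"
    then have "AE x in M. ennreal (\<Phi>' x) * epowr (ennreal (f x)) p = 0"
      by (simp add: norm_int_def zero_less_iff_neq_zero nn_integral_0_iff_AE)
    moreover have "AE x in M. 0 < \<Phi>' x" by (rule AE_M_I[OF Phi'_pos])
    ultimately have "AE x in M. f x \<le> 0"
    proof eventually_elim
      case (elim x)
      then have "epowr (ennreal (f x)) p = 0" by (auto simp: ennreal_eq_0_iff)
      then show ?case
        using epowr_pos_finite(1)[OF p(1), of "ennreal (f x)"]
        by (simp add: zero_less_iff_neq_zero ennreal_eq_0_iff)
    qed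
    then show False using * by blast
  qed
qed

lemma norm_int_Phi'_le: "norm_int \<Phi>' f \<le> norm_int \<Phi> f"
  unfolding norm_int_def
  by (intro nn_integral_mono mult_right_mono ennreal_leI Phi'_le) (simp_all add: space_restrict_space)

text \<open>Since \<open>1 / q < 0\<close>, positivity of the sequence norm means finiteness of the
  sum, and conversely.\<close>

lemma admissible_iff:
  "admissible p q \<sigma> \<beta> \<delta> \<mu> \<nu> f a \<longleftrightarrow>
    f \<in> borel_measurable M \<and> (\<forall>x>0. 0 \<le> f x) \<and> (\<forall>n\<ge>1. 0 \<le> a n) \<and>
    0 < norm_int \<Phi> f \<and> norm_int \<Phi> f < \<infinity> \<and> 0 < norm_sum a \<and> norm_sum a < \<infinity>"
  using epowr_pos_finite(1,2)[of "1 / p"] epowr_pos_finite(3,4)[of "1 / q"] p q_neg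
  by (auto simp: admissible_def norm_fun_eq norm_seq_eq)

text \<open>A zero term would contribute \<open>0\<close> to the power \<open>q < 0\<close>, that is
  \<open>\<infinity>\<close>.\<close>

lemma norm_sum_finite_pos:
  assumes "norm_sum a < \<infinity>" "\<forall>n\<ge>1. 0 \<le> a n" shows "0 < a (Suc n)"
proof (rule ccontr)
  assume "\<not> 0 < a (Suc n)"
  then have a: "a (Suc n) = 0" using assms(2) by (simp add: order.antisym)
  have "ennreal (\<Psi> (Suc n)) * epowr (ennreal (a (Suc n))) q = \<infinity>"
    using Psi_pos[of n] q_neg by (simp add: a epowr_0 ennreal_mult_top)
  moreover have "ennreal (\<Psi> (Suc n)) * epowr (ennreal (a (Suc n))) q \<le> norm_sum a"
    unfolding norm_sum_def using sum_le_suminf[of "\<lambda>n. ennreal (\<Psi> (Suc n)) * epowr (ennreal (a (Suc n))) q" "{n}"]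
    by simp
  ultimately show False using assms(1) by simp
qed

section \<open>Reverse Hoelder inequalities\<close>

definition I :: "(real \<Rightarrow> real) \<Rightarrow> nat \<Rightarrow> ennreal" where
  "I f n = (\<integral>\<^sup>+x. ennreal (K x n * f x) \<partial>M)"

definition G :: "(nat \<Rightarrow> real) \<Rightarrow> real \<Rightarrow> ennreal" where
  "G a x = (\<Sum>n. ennreal (K x n * a (Suc n)))"

text \<open>This is the dual weight \<open>\<Psi> (Suc n) powr (1 - p)\<close>, rewritten by
  \<open>p * q = p + q\<close>.\<close>

definition w_seq :: "nat \<Rightarrow> real" where
  "w_seq n = \<nu> (n + 2) * s n powr (p * \<sigma> - 1)"

text \<open>On the half-line this is the dual weight \<open>\<Phi>' x powr (1 - q)\<close>; as
  \<open>(1 - p) * (1 - q) = 1\<close>, its power \<open>1 - p\<close> is \<open>\<Phi>' x\<close>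
  again.\<close>

definition w_fun :: "real \<Rightarrow> real" where
  "w_fun x = (1 - \<theta> x) powr (1 - q) * \<mu> x * U \<mu> x powr (q * \<delta> * \<sigma> - 1)"

lemma w_seq_pos: "0 < w_seq n"
  using nu_pos[of "n + 2"] s_pos[of n] by (simp add: w_seq_def)

lemma w_fun_pos: "0 < x \<Longrightarrow> 0 < w_fun x"
  using theta_less_1[of x] mu_pos[of x] U_pos[of x] by (simp add: w_fun_def)

lemma measurable_w_fun [measurable]: "w_fun \<in> borel_measurable M"
  unfolding w_fun_def[abs_def] by measurable

lemma measurable_G [measurable]: "G a \<in> borel_measurable M"
  unfolding G_def[abs_def] by measurable

lemma bilinear_lhs_eq:
  "bilinear_lhs \<alpha> \<rho> \<gamma> \<beta> \<delta> \<mu> \<nu> f a = (\<Sum>n. \<integral>\<^sup>+x. ennreal (K x n * a (Suc n) * f x) \<partial>M)"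
  unfolding bilinear_lhs_def nn_integral_M
  by (intro suminf_cong nn_integral_M_cong) (simp add: kernel_eq)

lemma fun_lhs_eq:
  "fun_transform_lhs p \<alpha> \<rho> \<gamma> \<sigma> \<beta> \<delta> \<mu> \<nu> f = epowr (\<Sum>n. ennreal (w_seq n) * epowr (I f n) p) (1 / p)"
proof -
  have 1: "\<nu> (Suc n + 1) / (V \<nu> (Suc n) - \<beta>) powr (1 - p * \<sigma>) = w_seq n" for n
    using powr_minus_divide[of "s n" "1 - p * \<sigma>"] by (simp add: w_seq_def s_def[symmetric])
  have 2: "(\<integral>\<^sup>+x\<in>{0<..}. ennreal (kernel \<alpha> \<rho> \<gamma> \<beta> \<delta> \<mu> \<nu> x (Suc n) * f x) \<partial>lebesgue) = I f n" for n
    unfolding nn_integral_M I_def by (intro nn_integral_M_cong) (simp add: kernel_eq)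
  show ?thesis unfolding fun_transform_lhs_def 1 2 ..
qed

lemma seq_lhs_eq:
  "seq_transform_lhs q \<alpha> \<rho> \<gamma> \<sigma> \<beta> \<delta> \<mu> \<nu> a =
    epowr (\<integral>\<^sup>+x. ennreal (w_fun x) * epowr (G a x) q \<partial>M) (1 / q)"
proof -
  have "ennreal ((1 - \<theta> x) powr (1 - q) * \<mu> x / U \<mu> x powr (1 - q * \<delta> * \<sigma>)) *
      epowr (\<Sum>n. ennreal (kernel \<alpha> \<rho> \<gamma> \<beta> \<delta> \<mu> \<nu> x (Suc n) * a (Suc n))) q =
      ennreal (w_fun x) * epowr (G a x) q" if "0 < x" for x
    using powr_minus_divide[of "U \<mu> x" "1 - q * \<delta> * \<sigma>"] that
    by (simp add: w_fun_def G_def kernel_eq)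
  then show ?thesis
    unfolding seq_transform_lhs_def nn_integral_M by (simp cong: nn_integral_M_cong)
qed

lemma bilinear_lhs_eq_sum:
  assumes [measurable]: "f \<in> borel_measurable M" and a: "\<And>n. 0 \<le> a (Suc n)"
  shows "bilinear_lhs \<alpha> \<rho> \<gamma> \<beta> \<delta> \<mu> \<nu> f a = (\<Sum>n. ennreal (a (Suc n)) * I f n)"
proof -
  have "(\<integral>\<^sup>+x. ennreal (K x n * a (Suc n) * f x) \<partial>M) = ennreal (a (Suc n)) * I f n" for n
  proof -
    have "(\<integral>\<^sup>+x. ennreal (K x n * a (Suc n) * f x) \<partial>M) = (\<integral>\<^sup>+x. ennreal (a (Suc n)) * ennreal (K x n * f x) \<partial>M)"
      by (rule nn_integral_cong) (simp add: ennreal_mult'[OF a, symmetric] mult_ac)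
    then show ?thesis by (simp add: nn_integral_cmult I_def)
  qed
  then show ?thesis by (simp add: bilinear_lhs_eq)
qed

lemma bilinear_lhs_eq_integral:
  assumes [measurable]: "f \<in> borel_measurable M" and f: "\<And>x. 0 < x \<Longrightarrow> 0 \<le> f x"
  shows "bilinear_lhs \<alpha> \<rho> \<gamma> \<beta> \<delta> \<mu> \<nu> f a = (\<integral>\<^sup>+x. ennreal (f x) * G a x \<partial>M)"
proof -
  have "bilinear_lhs \<alpha> \<rho> \<gamma> \<beta> \<delta> \<mu> \<nu> f a = (\<integral>\<^sup>+x. (\<Sum>n. ennreal (K x n * a (Suc n) * f x)) \<partial>M)"
    unfolding bilinear_lhs_eq by (rule nn_integral_suminf[symmetric]) measurable
  also have "\<dots> = (\<integral>\<^sup>+x. ennreal (f x) * G a x \<partial>M)"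
  proof (rule nn_integral_M_cong)
    fix x :: real assume "0 < x"
    then have "ennreal (K x n * a (Suc n) * f x) = ennreal (f x) * ennreal (K x n * a (Suc n))" for n
      using f by (simp add: ennreal_mult'[symmetric] mult_ac)
    then show "(\<Sum>n. ennreal (K x n * a (Suc n) * f x)) = ennreal (f x) * G a x"
      by (simp add: G_def)
  qed
  finally show ?thesis .
qed

text \<open>After the root \<open>1 / p\<close>, the power \<open>(1 - p) / p\<close> of
  \<open>Z\<close> is cancelled by \<open>epowr Z (1 / q)\<close>; this needs \<open>Z\<close>
  positive and finite.\<close>

lemma reverse_Hoelder_root:
  assumes Z: "0 < Z" "Z < \<infinity>" and le: "X \<le> epowr B p * epowr Z (1 - p)"
  shows "epowr X (1 / p) * epowr Z (1 / q) \<le> B"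
proof -
  obtain z where z: "0 < z" "Z = ennreal z"
    using Z by (cases Z rule: ennreal_zero_top_cases) auto
  have "epowr X (1 / p) \<le> epowr (epowr B p * epowr Z (1 - p)) (1 / p)"
    using le epowr_less_iff[of "1 / p"] p by (metis not_less zero_less_divide_1_iff)
  also have "\<dots> = B * epowr Z ((1 - p) / p)"
    using p by (simp add: epowr_mult epowr_epowr epowr_1)
  finally have "epowr X (1 / p) * epowr Z (1 / q) \<le> B * (epowr Z ((1 - p) / p) * epowr Z (1 / q))"
    by (simp add: mult.assoc[symmetric] mult_right_mono)
  also have "epowr Z ((1 - p) / p) * epowr Z (1 / q) = 1"
    using z p by (simp add: epowr_ennreal ennreal_mult[symmetric] powr_add[symmetric] q_eq(2) add_divide_distrib[symmetric])
  finally show ?thesis by simp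
qed

text \<open>The terms under the root factor as \<open>(a I)^p * (\<Psi> a^q)^(1 - p)\<close>, where
  \<open>a\<close> drops out because \<open>p + q * (1 - p) = 0\<close>.\<close>

lemma reverse_Hoelder_seq:
  assumes a: "\<And>n. 0 < a (Suc n)" and N: "0 < norm_sum a" "norm_sum a < \<infinity>"
    and [measurable]: "f \<in> borel_measurable M"
  shows "fun_transform_lhs p \<alpha> \<rho> \<gamma> \<sigma> \<beta> \<delta> \<mu> \<nu> f * norm_seq q \<Psi> a \<le> bilinear_lhs \<alpha> \<rho> \<gamma> \<beta> \<delta> \<mu> \<nu> f a"
proof -
  let ?A = "\<lambda>n. ennreal (a (Suc n)) * I f n"
  let ?B = "\<lambda>n. ennreal (\<Psi> (Suc n)) * epowr (ennreal (a (Suc n))) q"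
  have eq: "ennreal (w_seq n) * epowr (I f n) p = epowr (?A n) p * epowr (?B n) (1 - p)" for n
  proof -
    have "w_seq n = a (Suc n) powr p * (\<Psi> (Suc n) * a (Suc n) powr q) powr (1 - p)"
    proof (rule ln_eq_imp_eq)
      have "ln (a (Suc n) powr p * (\<Psi> (Suc n) * a (Suc n) powr q) powr (1 - p)) =
          p * ln (a (Suc n)) + (1 - p) * (((q * (1 - \<sigma>) - 1) * ln (s n) + (1 - q) * ln (\<nu> (n + 2))) + q * ln (a (Suc n)))"
        using a[of n] Psi_pos[of n] s_pos[of n] nu_pos[of "n + 2"]
        by (simp add: ln_mult ln_powr Psi_eq)
      also have "\<dots> = ln (\<nu> (n + 2)) + (p * \<sigma> - 1) * ln (s n)"
        using q_eq(1) by algebra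
      also have "\<dots> = ln (w_seq n)"
        using s_pos[of n] nu_pos[of "n + 2"] by (simp add: w_seq_def ln_mult ln_powr)
      finally show "ln (w_seq n) = ln (a (Suc n) powr p * (\<Psi> (Suc n) * a (Suc n) powr q) powr (1 - p))" ..
    qed (use a[of n] Psi_pos[of n] w_seq_pos in auto)
    then have "ennreal (w_seq n) = epowr (ennreal (a (Suc n))) p * epowr (?B n) (1 - p)"
      using a[of n] Psi_pos[of n] by (simp add: epowr_ennreal ennreal_mult[symmetric])
    then show ?thesis using p by (simp add: epowr_mult mult_ac)
  qed
  have "(\<Sum>n. ennreal (w_seq n) * epowr (I f n) p) \<le> epowr (\<Sum>n. ?A n) p * epowr (norm_sum a) (1 - p)"
    unfolding eq norm_sum_def using nn_integral_Hoelder[of ?A "count_space UNIV" ?B p] p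
    by (simp add: nn_integral_count_space_nat)
  from reverse_Hoelder_root[OF N this] show ?thesis
    using a by (simp add: fun_lhs_eq norm_seq_eq bilinear_lhs_eq_sum less_imp_le)
qed

lemma G_pos: "(\<And>n. 0 < a (Suc n)) \<Longrightarrow> 0 < x \<Longrightarrow> 0 < G a x"
proof -
  assume a: "\<And>n. 0 < a (Suc n)" and x: "0 < x"
  have "0 < ennreal (K x 0 * a (Suc 0))" using a[of 0] K_pos[OF x, of 0] by simp
  also have "\<dots> \<le> G a x"
    unfolding G_def using sum_le_suminf[of "\<lambda>n. ennreal (K x n * a (Suc n))" "{0}"] by simp
  finally show ?thesis .
qed

text \<open>The factorisation is now \<open>\<Phi>' f^p = (f G)^p * (w_fun G^q)^(1 - p)\<close>. The
  hypothesis on the transform makes \<open>J\<close> finite, since \<open>1 / q < 0\<close>.\<close>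

lemma reverse_Hoelder_fun:
  assumes a: "\<And>n. 0 < a (Suc n)"
    and f [measurable]: "f \<in> borel_measurable M" "\<And>x. 0 < x \<Longrightarrow> 0 \<le> f x"
    and N: "0 < norm_int \<Phi>' f"
    and B: "bilinear_lhs \<alpha> \<rho> \<gamma> \<beta> \<delta> \<mu> \<nu> f a < \<infinity>"
    and L: "0 < seq_transform_lhs q \<alpha> \<rho> \<gamma> \<sigma> \<beta> \<delta> \<mu> \<nu> a"
  shows "norm_fun p \<Phi>' f * seq_transform_lhs q \<alpha> \<rho> \<gamma> \<sigma> \<beta> \<delta> \<mu> \<nu> a \<le> bilinear_lhs \<alpha> \<rho> \<gamma> \<beta> \<delta> \<mu> \<nu> f a"
proof -
  let ?A = "\<lambda>x. ennreal (f x) * G a x"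
  let ?B = "\<lambda>x. ennreal (w_fun x) * epowr (G a x) q"
  define J where "J = (\<integral>\<^sup>+x. ?B x \<partial>M)"
  have B_eq: "bilinear_lhs \<alpha> \<rho> \<gamma> \<beta> \<delta> \<mu> \<nu> f a = (\<integral>\<^sup>+x. ?A x \<partial>M)"
    by (rule bilinear_lhs_eq_integral) (use f in auto)
  \<comment> \<open>At a point with \<open>f x > 0\<close> and \<open>G a x = top\<close> the
    factorisation would read \<open>top * 0\<close>. Finiteness of the bilinear form confines such
    points to a null set.\<close>
  have "AE x in M. ?A x \<noteq> \<infinity>"
    using B by (intro nn_integral_PInf_AE) (simp_all add: B_eq)
  moreover have "AE x in M. 0 < x" by (rule AE_M_I)
  ultimately have "AE x in M. ennreal (\<Phi>' x) * epowr (ennreal (f x)) p = epowr (?A x) p * epowr (?B x) (1 - p)"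
  proof eventually_elim
    case (elim x)
    show ?case
    proof (cases "f x = 0")
      case True
      then show ?thesis using p by (simp add: epowr_0)
    next
      case False
      then have fx: "0 < f x" using f(2) elim by (simp add: order.not_eq_order_implies_strict)
      then have "G a x \<noteq> top" using elim by (auto simp: ennreal_mult_top)
      then obtain y where y: "0 < y" "G a x = ennreal y"
        using G_pos[of a x] a elim(2) by (cases "G a x" rule: ennreal_zero_top_cases) auto
      note pos = fx y(1) w_fun_pos[OF elim(2)] Phi'_pos[OF elim(2)] U_pos[OF elim(2)] mu_pos[OF elim(2)] theta_less_1[OF elim(2)]
      have "\<Phi>' x * f x powr p = (f x * y) powr p * (w_fun x * y powr q) powr (1 - p)"
      proof (rule ln_eq_imp_eq)
        have "ln ((f x * y) powr p * (w_fun x * y powr q) powr (1 - p)) =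
            p * (ln (f x) + ln y) + (1 - p) * (((1 - q) * ln (1 - \<theta> x) + ln (\<mu> x) + (q * \<delta> * \<sigma> - 1) * ln (U \<mu> x)) + q * ln y)"
          using pos by (simp add: ln_mult ln_powr w_fun_def)
        also have "\<dots> = (ln (1 - \<theta> x) + ((p * (1 - \<delta> * \<sigma>) - 1) * ln (U \<mu> x) + (1 - p) * ln (\<mu> x))) + p * ln (f x)"
          using q_eq(1) by algebra
        also have "\<dots> = ln (\<Phi>' x * f x powr p)"
          using pos by (simp add: ln_mult ln_powr Phi_tilde_def Phi_eq[OF elim(2)])
        finally show "ln (\<Phi>' x * f x powr p) = ln ((f x * y) powr p * (w_fun x * y powr q) powr (1 - p))" ..
      qed (use pos in auto)
      then show ?thesis
        using pos by (simp add: y(2) epowr_ennreal ennreal_mult[symmetric])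
    qed
  qed
  then have "norm_int \<Phi>' f = (\<integral>\<^sup>+x. epowr (?A x) p * epowr (?B x) (1 - p) \<partial>M)"
    unfolding norm_int_def by (rule nn_integral_cong_AE)
  also have "\<dots> \<le> epowr (bilinear_lhs \<alpha> \<rho> \<gamma> \<beta> \<delta> \<mu> \<nu> f a) p * epowr J (1 - p)"
    unfolding B_eq J_def
    by (rule nn_integral_Hoelder) (use p in simp_all)
  finally have le: "norm_int \<Phi>' f \<le> epowr (bilinear_lhs \<alpha> \<rho> \<gamma> \<beta> \<delta> \<mu> \<nu> f a) p * epowr J (1 - p)" .
  have "J \<noteq> 0" using le N p by (auto simp: epowr_0)
  moreover have "J < \<infinity>"
    using L epowr_pos_finite(3)[of "1 / q" J] q_neg by (simp add: seq_lhs_eq J_def)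
  ultimately show ?thesis
    using reverse_Hoelder_root[OF _ _ le] by (simp add: norm_fun_eq seq_lhs_eq J_def zero_less_iff_neq_zero)
qed

section \<open>The inequalities with the constant k\<close>

text \<open>Hoelder with \<open>r = 1 / (1 - q)\<close> splits the weight sum into \<open>H\<close>
  and \<open>G a x\<close>. Raising to the power \<open>1 - q\<close> gives
  \<open>L^(1 - q) < H * G^(- q)\<close>, and \<open>G^(- q)\<close> is then moved to the
  left.\<close>

lemma seq_weight_estimate:
  assumes a: "\<And>n. 0 < a (Suc n)" and x: "0 < x"
  shows "ennreal (w_fun x) * epowr (G a x) q <
    (\<Sum>n. ennreal (k \<sigma> powr (q - 1) * (a (Suc n) powr q * \<nu> (n + 2) powr (1 - q) * s n powr ((\<sigma> - 1) * (1 - q)))) *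
      ennreal (K x n * (\<mu> x * U \<mu> x powr (\<delta> * \<sigma> - 1))))"
proof -
  define L where "L = k \<sigma> * (1 - \<theta> x) * Y x powr (- \<sigma>)"
  define m where "m n = K x n * (\<nu> (n + 2) * s n powr (\<sigma> - 1))" for n
  \<comment> \<open>Solved from \<open>m n = (b n)^r * (K x n * a (Suc n))^(1 - r)\<close>; the
    factor \<open>a\<close> cancels because \<open>r * (1 - q) = 1\<close>.\<close>
  define b where "b n = K x n * (a (Suc n) powr q * \<nu> (n + 2) powr (1 - q) * s n powr ((\<sigma> - 1) * (1 - q)))" for n
  define H where "H = (\<Sum>n. ennreal (b n))"
  define r where "r = 1 / (1 - q)"
  have r: "0 < r" "r < 1" "r * (1 - q) = 1" using q_neg by (auto simp: r_def)
  note pos = K_pos[OF x] nu_pos[of "_ + 2"] s_pos a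
  have L: "0 < L" using k_sigma_pos theta_less_1[OF x] Y_pos[OF x] U_pos[OF x] by (simp add: L_def)
  have b: "0 < b n" for n using pos(1)[of n] pos(2)[of n] pos(3)[of n] pos(4)[of n] by (simp add: b_def)
  have m_eq: "ennreal (m n) = epowr (ennreal (b n)) r * epowr (ennreal (K x n * a (Suc n))) (1 - r)" for n
  proof -
    note pos = pos(1)[of n] pos(2)[of n] pos(3)[of n] pos(4)[of n]
    have "m n = b n powr r * (K x n * a (Suc n)) powr (1 - r)"
    proof (rule ln_eq_imp_eq)
      have "ln (b n powr r * (K x n * a (Suc n)) powr (1 - r)) =
          r * (ln (K x n) + ((q * ln (a (Suc n)) + (1 - q) * ln (\<nu> (n + 2))) + (\<sigma> - 1) * (1 - q) * ln (s n))) +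
          (1 - r) * (ln (K x n) + ln (a (Suc n)))"
        using pos b[of n] by (simp add: ln_mult ln_powr b_def)
      also have "\<dots> = ln (K x n) + (ln (\<nu> (n + 2)) + (\<sigma> - 1) * ln (s n))"
        using r(3) by algebra
      also have "\<dots> = ln (m n)"
        using pos by (simp add: ln_mult ln_powr m_def)
      finally show "ln (m n) = ln (b n powr r * (K x n * a (Suc n)) powr (1 - r))" ..
    qed (use pos b[of n] in \<open>auto simp: m_def\<close>)
    then show ?thesis using pos b[of n] by (simp add: epowr_ennreal ennreal_mult[symmetric])
  qed
  have "ennreal L < (\<Sum>n. ennreal (m n))"
    using weight_sum[OF x] by (simp add: L_def m_def)
  also have "\<dots> \<le> epowr H r * epowr (G a x) (1 - r)"
    unfolding m_eq H_def G_def
    using nn_integral_Hoelder[of "\<lambda>n. ennreal (b n)" "count_space UNIV" "\<lambda>n. ennreal (K x n * a (Suc n))" r] r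
    by (simp add: nn_integral_count_space_nat)
  finally have "epowr (ennreal L) (1 - q) < epowr (epowr H r * epowr (G a x) (1 - r)) (1 - q)"
    using q_neg by (simp add: epowr_less_iff)
  also have "\<dots> = H * epowr (G a x) (- q)"
  proof -
    have "(1 - r) * (1 - q) = - q" using r(3) by (simp add: algebra_simps)
    then show ?thesis using r q_neg by (simp add: epowr_mult epowr_epowr epowr_1)
  qed
  finally have less: "ennreal (L powr (1 - q)) < H * epowr (G a x) (- q)"
    using L by (simp add: epowr_ennreal)
  have H: "0 < H"
    using less by (metis mult_zero_left not_less_zero zero_less_iff_neq_zero)
  \<comment> \<open>If \<open>G a x = top\<close>, the left side is \<open>0\<close>, which is why
    \<open>H > 0\<close> is recorded beforehand.\<close>
  have "ennreal (L powr (1 - q)) * epowr (G a x) q < H"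
  proof (cases "G a x" rule: ennreal_zero_top_cases)
    case zero
    then show ?thesis using G_pos[of a x] a x by simp
  next
    case top
    then show ?thesis using q_neg H by (simp add: epowr_top)
  next
    case (real y)
    have "ennreal (y powr q) * ennreal (L powr (1 - q)) < ennreal (y powr q) * (H * ennreal (y powr (- q)))"
      using less real by (intro ennreal_mult_strict_left_mono) (auto simp: epowr_ennreal)
    moreover have "ennreal (y powr q) * (H * ennreal (y powr (- q))) = H"
      using real(1) by (simp add: mult.left_commute ennreal_mult[symmetric] powr_add[symmetric])
    ultimately show ?thesis using real by (simp add: epowr_ennreal mult.commute)
  qed
  \<comment> \<open>What \<open>L powr (1 - q)\<close> leaves of \<open>w_fun x\<close>. It contains
    the density of the weight integral, so each \<open>c * b n\<close> can be integrated over
    \<open>x\<close> exactly.\<close>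
  define c where "c = k \<sigma> powr (q - 1) * (\<mu> x * U \<mu> x powr (\<delta> * \<sigma> - 1))"
  have c: "0 < c" using k_sigma_pos mu_pos[OF x] U_pos[OF x] by (simp add: c_def)
  have w: "w_fun x = c * L powr (1 - q)"
  proof (rule ln_eq_imp_eq)
    note pos = k_sigma_pos mu_pos[OF x] U_pos[OF x] theta_less_1[OF x]
    have "ln (c * L powr (1 - q)) = ((q - 1) * ln (k \<sigma>) + (ln (\<mu> x) + (\<delta> * \<sigma> - 1) * ln (U \<mu> x))) +
        (1 - q) * ((ln (k \<sigma>) + ln (1 - \<theta> x)) + - (\<delta> * \<sigma>) * ln (U \<mu> x))"
      using pos L by (simp add: ln_mult ln_powr c_def L_def powr_powr)
    also have "\<dots> = ((1 - q) * ln (1 - \<theta> x) + ln (\<mu> x)) + (q * \<delta> * \<sigma> - 1) * ln (U \<mu> x)"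
      by algebra
    also have "\<dots> = ln (w_fun x)"
      using pos by (simp add: ln_mult ln_powr w_fun_def)
    finally show "ln (w_fun x) = ln (c * L powr (1 - q))" ..
  qed (use c L w_fun_pos[OF x] in auto)
  have "ennreal (w_fun x) * epowr (G a x) q = ennreal c * (ennreal (L powr (1 - q)) * epowr (G a x) q)"
    using c by (simp add: w ennreal_mult mult.assoc)
  also have "\<dots> < ennreal c * H"
    using c \<open>ennreal (L powr (1 - q)) * epowr (G a x) q < H\<close> by (intro ennreal_mult_strict_left_mono) auto
  also have "\<dots> = (\<Sum>n. ennreal (c * b n))"
    unfolding H_def ennreal_suminf_cmult[symmetric] using c by (simp add: ennreal_mult')
  also have "(\<lambda>n. ennreal (c * b n)) =
      (\<lambda>n. ennreal (k \<sigma> powr (q - 1) * (a (Suc n) powr q * \<nu> (n + 2) powr (1 - q) * s n powr ((\<sigma> - 1) * (1 - q)))) *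
      ennreal (K x n * (\<mu> x * U \<mu> x powr (\<delta> * \<sigma> - 1))))"
    using pos(1) mu_pos[OF x]
    by (intro ext) (simp add: ennreal_mult''[symmetric] less_imp_le c_def b_def mult_ac)
  finally show ?thesis .
qed

text \<open>Integrating the pointwise estimate term by term gives exactly
  \<open>k \<sigma> powr q\<close> times the sum of the norm.\<close>

lemma seq_transform_ineq_k: "seq_transform_ineq p q \<alpha> \<rho> \<gamma> \<sigma> \<beta> \<delta> \<mu> \<nu> (k \<sigma>)"
  unfolding seq_transform_ineq_def
proof (intro allI impI)
  fix f a assume "admissible p q \<sigma> \<beta> \<delta> \<mu> \<nu> f a"
  then have N: "0 < norm_sum a" "norm_sum a < \<infinity>" and a: "\<And>n. 0 < a (Suc n)"
    using norm_sum_finite_pos by (auto simp: admissible_iff)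
  define F where "F x = ennreal (w_fun x) * epowr (G a x) q" for x
  define c where "c n = k \<sigma> powr (q - 1) * (a (Suc n) powr q * \<nu> (n + 2) powr (1 - q) * s n powr ((\<sigma> - 1) * (1 - q)))" for n
  define E where "E x = (\<Sum>n. ennreal (c n) * ennreal (K x n * (\<mu> x * U \<mu> x powr (\<delta> * \<sigma> - 1))))" for x
  have [measurable]: "F \<in> borel_measurable M" "E \<in> borel_measurable M"
    unfolding F_def[abs_def] E_def[abs_def] by measurable
  have less: "F x < E x" if "0 < x" for x
    unfolding F_def E_def c_def by (rule seq_weight_estimate) (use a that in auto)
  have "(\<integral>\<^sup>+x. E x \<partial>M) = (\<Sum>n. ennreal (c n) * ennreal (k \<sigma> * s n powr (- \<sigma>)))"
    unfolding E_def
    by (subst nn_integral_suminf) (simp_all add: nn_integral_cmult weight_integral[OF gamma_sigma])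
  also have "\<dots> = (\<Sum>n. ennreal (k \<sigma> powr q) * (ennreal (\<Psi> (Suc n)) * epowr (ennreal (a (Suc n))) q))"
  proof (rule suminf_cong)
    fix n
    note pos = a[of n] nu_pos[of "n + 2"] s_pos[of n] k_sigma_pos Psi_pos[of n]
    have "c n * (k \<sigma> * s n powr (- \<sigma>)) = k \<sigma> powr q * (\<Psi> (Suc n) * a (Suc n) powr q)"
    proof (rule ln_eq_imp_eq)
      have "ln (c n * (k \<sigma> * s n powr (- \<sigma>))) =
          ((q - 1) * ln (k \<sigma>) + ((q * ln (a (Suc n)) + (1 - q) * ln (\<nu> (n + 2))) + (\<sigma> - 1) * (1 - q) * ln (s n))) +
          (ln (k \<sigma>) + - \<sigma> * ln (s n))"
        using pos by (simp add: ln_mult ln_powr c_def)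
      also have "\<dots> = q * ln (k \<sigma>) + (((q * (1 - \<sigma>) - 1) * ln (s n) + (1 - q) * ln (\<nu> (n + 2))) + q * ln (a (Suc n)))"
        by algebra
      also have "\<dots> = ln (k \<sigma> powr q * (\<Psi> (Suc n) * a (Suc n) powr q))"
        using pos by (simp add: ln_mult ln_powr Psi_eq)
      finally show "ln (c n * (k \<sigma> * s n powr (- \<sigma>))) = ln (k \<sigma> powr q * (\<Psi> (Suc n) * a (Suc n) powr q))" .
    qed (use pos in \<open>auto simp: c_def\<close>)
    then show "ennreal (c n) * ennreal (k \<sigma> * s n powr (- \<sigma>)) =
        ennreal (k \<sigma> powr q) * (ennreal (\<Psi> (Suc n)) * epowr (ennreal (a (Suc n))) q)"
      using pos by (simp add: epowr_ennreal ennreal_mult''[symmetric])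
  qed
  also have "\<dots> = ennreal (k \<sigma> powr q) * norm_sum a"
    by (simp add: norm_sum_def)
  finally have E: "(\<integral>\<^sup>+x. E x \<partial>M) = ennreal (k \<sigma> powr q) * norm_sum a" .
  have fin: "(\<integral>\<^sup>+x. E x \<partial>M) < \<infinity>"
    unfolding E using N by (simp add: ennreal_mult_less_top)
  have "(\<integral>\<^sup>+x. F x \<partial>M) < (\<integral>\<^sup>+x. E x \<partial>M)"
  proof (rule nn_integral_less)
    have "(\<integral>\<^sup>+x. F x \<partial>M) \<le> (\<integral>\<^sup>+x. E x \<partial>M)"
      by (intro nn_integral_mono_AE AE_M_I less_imp_le less)
    then show "(\<integral>\<^sup>+x. F x \<partial>M) \<noteq> \<infinity>" using fin by auto
    show "AE x in M. F x \<le> E x" by (intro AE_M_I less_imp_le less)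
    show "\<not> (AE x in M. E x \<le> F x)"
    proof
      assume "AE x in M. E x \<le> F x"
      moreover have "AE x in M. F x < E x" by (intro AE_M_I less)
      ultimately have "AE x in M. False" by eventually_elim simp
      then show False using M_not_AE_False by simp
    qed
  qed simp_all
  \<comment> \<open>The root with \<open>1 / q < 0\<close> reverses the inequality and turns an
    upper estimate into the lower one that is claimed.\<close>
  then have "epowr (ennreal (k \<sigma> powr q) * norm_sum a) (1 / q) < epowr (\<integral>\<^sup>+x. F x \<partial>M) (1 / q)"
    unfolding E using q_neg by (intro epowr_less_neg) auto
  moreover have "epowr (ennreal (k \<sigma> powr q) * norm_sum a) (1 / q) = ennreal (k \<sigma>) * norm_seq q \<Psi> a"
  proof -
    obtain S where S: "0 < S" "norm_sum a = ennreal S"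
      using N by (cases "norm_sum a" rule: ennreal_zero_top_cases) auto
    then show ?thesis
      using k_sigma_pos q_neg
      by (simp add: norm_seq_eq epowr_ennreal ennreal_mult[symmetric] powr_mult powr_powr)
  qed
  ultimately show "ennreal (k \<sigma>) * norm_seq q \<Psi> a < seq_transform_lhs q \<alpha> \<rho> \<gamma> \<sigma> \<beta> \<delta> \<mu> \<nu> a"
    by (simp add: seq_lhs_eq F_def)
qed

text \<open>Hoelder in \<open>x\<close> for fixed \<open>n\<close>, with exponent
  \<open>1 - p\<close> on the weight integral and \<open>p\<close> on \<open>I f n\<close>. Summing
  the left sides over \<open>n\<close> will bring out the weight sum.\<close>

lemma fun_weight_estimate:
  assumes f [measurable]: "f \<in> borel_measurable M" "\<And>x. 0 < x \<Longrightarrow> 0 \<le> f x"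
  shows "(\<integral>\<^sup>+x. ennreal (k \<sigma> powr (p - 1) * (K x n * (\<nu> (n + 2) * s n powr (\<sigma> - 1))) *
      (\<mu> x powr (1 - p) * U \<mu> x powr ((\<delta> * \<sigma> - 1) * (1 - p)))) * epowr (ennreal (f x)) p \<partial>M) \<le>
    ennreal (w_seq n) * epowr (I f n) p"
proof -
  let ?A = "\<lambda>x. ennreal (K x n * (\<mu> x * U \<mu> x powr (\<delta> * \<sigma> - 1)))"
  let ?B = "\<lambda>x. ennreal (K x n * f x)"
  \<comment> \<open>Normalised so that the power \<open>1 - p\<close> of the weight integral turns
    \<open>c\<close> into \<open>w_seq n\<close>.\<close>
  define c where "c = w_seq n * (k \<sigma> * s n powr (- \<sigma>)) powr (p - 1)"
  have c: "0 < c" using w_seq_pos k_sigma_pos s_pos[of n] by (simp add: c_def)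
  have "(\<integral>\<^sup>+x. ennreal (k \<sigma> powr (p - 1) * (K x n * (\<nu> (n + 2) * s n powr (\<sigma> - 1))) *
      (\<mu> x powr (1 - p) * U \<mu> x powr ((\<delta> * \<sigma> - 1) * (1 - p)))) * epowr (ennreal (f x)) p \<partial>M) =
      (\<integral>\<^sup>+x. ennreal c * (epowr (?A x) (1 - p) * epowr (?B x) (1 - (1 - p))) \<partial>M)"
  proof (rule nn_integral_M_cong)
    fix x :: real assume x: "0 < x"
    note pos = K_pos[OF x, of n] nu_pos[of "n + 2"] s_pos[of n] mu_pos[OF x] U_pos[OF x] k_sigma_pos w_seq_pos[of n] c
    have "k \<sigma> powr (p - 1) * (K x n * (\<nu> (n + 2) * s n powr (\<sigma> - 1))) *
        (\<mu> x powr (1 - p) * U \<mu> x powr ((\<delta> * \<sigma> - 1) * (1 - p))) =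
        c * ((K x n * (\<mu> x * U \<mu> x powr (\<delta> * \<sigma> - 1))) powr (1 - p) * K x n powr p)" (is "?l = ?r")
    proof (rule ln_eq_imp_eq)
      have "ln ?r = ((ln (\<nu> (n + 2)) + (p * \<sigma> - 1) * ln (s n)) + (p - 1) * (ln (k \<sigma>) + - \<sigma> * ln (s n))) +
          ((1 - p) * (ln (K x n) + (ln (\<mu> x) + (\<delta> * \<sigma> - 1) * ln (U \<mu> x))) + p * ln (K x n))"
        using pos by (simp add: ln_mult ln_powr c_def w_seq_def)
      also have "\<dots> = ((p - 1) * ln (k \<sigma>) + (ln (K x n) + (ln (\<nu> (n + 2)) + (\<sigma> - 1) * ln (s n)))) +
          ((1 - p) * ln (\<mu> x) + (\<delta> * \<sigma> - 1) * (1 - p) * ln (U \<mu> x))"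
        by algebra
      also have "\<dots> = ln ?l"
        using pos by (simp add: ln_mult ln_powr)
      finally show "ln ?l = ln ?r" ..
    qed (use pos in auto)
    moreover have "epowr (?B x) p = ennreal (K x n powr p) * epowr (ennreal (f x)) p"
      using pos p f(2)[OF x] by (simp add: ennreal_mult epowr_mult epowr_ennreal)
    ultimately show "ennreal ?l * epowr (ennreal (f x)) p =
        ennreal c * (epowr (?A x) (1 - p) * epowr (?B x) (1 - (1 - p)))"
      using pos by (simp add: epowr_ennreal ennreal_mult''[symmetric] mult.assoc[symmetric])
  qed
  also have "\<dots> = ennreal c * (\<integral>\<^sup>+x. epowr (?A x) (1 - p) * epowr (?B x) (1 - (1 - p)) \<partial>M)"
    by (rule nn_integral_cmult) measurable
  also have "\<dots> \<le> ennreal c * (epowr (\<integral>\<^sup>+x. ?A x \<partial>M) (1 - p) * epowr (I f n) (1 - (1 - p)))"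
    unfolding I_def using p by (intro mult_left_mono nn_integral_Hoelder) auto
  also have "\<dots> = ennreal (c * (k \<sigma> * s n powr (- \<sigma>)) powr (1 - p)) * epowr (I f n) p"
  proof -
    have "0 < k \<sigma> * s n powr (- \<sigma>)" using k_sigma_pos s_pos[of n] by simp
    then show ?thesis
      unfolding weight_integral[OF gamma_sigma] using c
      by (simp only: epowr_ennreal) (simp add: ennreal_mult' mult.assoc)
  qed
  also have "c * (k \<sigma> * s n powr (- \<sigma>)) powr (1 - p) = w_seq n"
    using k_sigma_pos s_pos[of n] by (simp add: c_def mult.assoc powr_add[symmetric])
  finally show ?thesis .
qed

lemma fun_transform_ineq_k: "fun_transform_ineq p q \<alpha> \<rho> \<gamma> \<sigma> \<beta> \<delta> \<mu> \<nu> (k \<sigma>)"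
  unfolding fun_transform_ineq_def
proof (intro allI impI)
  fix f a assume adm: "admissible p q \<sigma> \<beta> \<delta> \<mu> \<nu> f a"
  then have f [measurable]: "f \<in> borel_measurable M" "\<And>x. 0 < x \<Longrightarrow> 0 \<le> f x"
    and N: "0 < norm_int \<Phi> f" "norm_int \<Phi> f < \<infinity>"
    by (auto simp: admissible_iff)
  define v where "v x = \<mu> x powr (1 - p) * U \<mu> x powr ((\<delta> * \<sigma> - 1) * (1 - p))" for x
  define m where "m x n = K x n * (\<nu> (n + 2) * s n powr (\<sigma> - 1))" for x n
  define c where "c = k \<sigma> powr (p - 1)"
  define F where "F x = ennreal (k \<sigma> powr p) * (ennreal (\<Phi>' x) * epowr (ennreal (f x)) p)" for x
  define E where "E x = (\<Sum>n. ennreal (c * m x n * v x) * epowr (ennreal (f x)) p)" for x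
  have c: "0 < c" using k_sigma_pos by (simp add: c_def)
  have [measurable]: "F \<in> borel_measurable M" "E \<in> borel_measurable M"
    unfolding F_def[abs_def] E_def[abs_def] v_def m_def by measurable
  \<comment> \<open>Strictness is available only where \<open>f x > 0\<close>; that this set is not
    null follows from the positive norm of \<open>f\<close>.\<close>
  have EF: "F x \<le> E x \<and> (0 < f x \<longrightarrow> F x < E x)" if x: "0 < x" for x
  proof (cases "f x = 0")
    case True
    then show ?thesis using p by (simp add: F_def E_def epowr_0)
  next
    case False
    then have fx: "0 < f x" using f(2)[OF x] by simp
    define L where "L = k \<sigma> * (1 - \<theta> x) * Y x powr (- \<sigma>)"
    note pos = k_sigma_pos mu_pos[OF x] U_pos[OF x] theta_less_1[OF x] Phi'_pos[OF x] fx c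
    have v: "0 < v x" using pos by (simp add: v_def)
    have L: "0 < L" using pos by (simp add: L_def)
    have eq: "k \<sigma> powr p * \<Phi>' x = c * v x * L"
    proof (rule ln_eq_imp_eq)
      have "ln (c * v x * L) = ((p - 1) * ln (k \<sigma>) + ((1 - p) * ln (\<mu> x) + (\<delta> * \<sigma> - 1) * (1 - p) * ln (U \<mu> x))) +
          ((ln (k \<sigma>) + ln (1 - \<theta> x)) + - (\<delta> * \<sigma>) * ln (U \<mu> x))"
        using pos v L by (simp add: ln_mult ln_powr c_def v_def L_def powr_powr)
      also have "\<dots> = p * ln (k \<sigma>) + (ln (1 - \<theta> x) + ((p * (1 - \<delta> * \<sigma>) - 1) * ln (U \<mu> x) + (1 - p) * ln (\<mu> x)))"
        by algebra
      also have "\<dots> = ln (k \<sigma> powr p * \<Phi>' x)"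
        using pos by (simp add: ln_mult ln_powr Phi_tilde_def Phi_eq[OF x])
      finally show "ln (k \<sigma> powr p * \<Phi>' x) = ln (c * v x * L)" ..
    qed (use pos v L in auto)
    define d where "d = c * v x * f x powr p"
    have d: "0 < d" using pos v by (simp add: d_def)
    have "F x = ennreal d * ennreal L"
      using pos eq d L by (simp add: F_def epowr_ennreal ennreal_mult[symmetric] d_def mult_ac)
    also have "\<dots> < ennreal d * (\<Sum>n. ennreal (m x n))"
      using weight_sum[OF x] d by (intro ennreal_mult_strict_left_mono) (auto simp: L_def m_def)
    also have "\<dots> = E x"
      unfolding ennreal_suminf_cmult[symmetric] E_def
      using pos v d by (simp add: epowr_ennreal ennreal_mult'[symmetric] ennreal_mult''[symmetric] d_def mult_ac)
    finally show ?thesis by simp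
  qed
  have intF: "(\<integral>\<^sup>+x. F x \<partial>M) = ennreal (k \<sigma> powr p) * norm_int \<Phi>' f"
    unfolding F_def norm_int_def by (rule nn_integral_cmult) measurable
  have "(\<integral>\<^sup>+x. F x \<partial>M) < (\<integral>\<^sup>+x. E x \<partial>M)"
  proof (rule nn_integral_less)
    show "(\<integral>\<^sup>+x. F x \<partial>M) \<noteq> \<infinity>"
      using norm_int_Phi'_le[of f] N(2) by (auto simp: intF ennreal_mult_eq_top_iff top_unique)
    show "AE x in M. F x \<le> E x" by (rule AE_M_I) (use EF in blast)
    show "\<not> (AE x in M. E x \<le> F x)"
    proof
      assume "AE x in M. E x \<le> F x"
      moreover have "AE x in M. 0 < f x \<longrightarrow> F x < E x" by (rule AE_M_I) (use EF in blast)
      ultimately have "AE x in M. f x \<le> 0" by eventually_elim (auto simp: not_less[symmetric])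
      then show False using norm_int_Phi'_pos(2)[OF f(1) N(1)] by simp
    qed
  qed simp_all
  also have "(\<integral>\<^sup>+x. E x \<partial>M) = (\<Sum>n. \<integral>\<^sup>+x. ennreal (c * m x n * v x) * epowr (ennreal (f x)) p \<partial>M)"
    unfolding E_def m_def v_def by (rule nn_integral_suminf) measurable
  also have "\<dots> \<le> (\<Sum>n. ennreal (w_seq n) * epowr (I f n) p)"
    unfolding c_def m_def v_def by (intro suminf_le fun_weight_estimate f) auto
  finally have "epowr (ennreal (k \<sigma> powr p) * norm_int \<Phi>' f) (1 / p) <
      epowr (\<Sum>n. ennreal (w_seq n) * epowr (I f n) p) (1 / p)"
    unfolding intF using p by (simp add: epowr_less_iff)
  moreover have "epowr (ennreal (k \<sigma> powr p) * norm_int \<Phi>' f) (1 / p) = ennreal (k \<sigma>) * norm_fun p \<Phi>' f"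
    using p k_sigma_pos by (simp add: epowr_mult norm_fun_eq epowr_ennreal powr_powr)
  ultimately show "ennreal (k \<sigma>) * norm_fun p \<Phi>' f < fun_transform_lhs p \<alpha> \<rho> \<gamma> \<sigma> \<beta> \<delta> \<mu> \<nu> f"
    by (simp add: fun_lhs_eq)
qed

section \<open>From the transform inequalities to the bilinear one, for an arbitrary
  constant\<close>

lemma norms_finite_pos:
  assumes "admissible p q \<sigma> \<beta> \<delta> \<mu> \<nu> f a"
  shows "0 < norm_seq q \<Psi> a" "norm_seq q \<Psi> a < \<infinity>"
    "0 < norm_fun p \<Phi>' f" "norm_fun p \<Phi>' f < \<infinity>"
proof -
  show "0 < norm_seq q \<Psi> a" "norm_seq q \<Psi> a < \<infinity>"
    using assms by (auto simp: admissible_def)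
  show "0 < norm_fun p \<Phi>' f"
    using assms norm_int_Phi'_pos(1)[of f] epowr_pos_finite(1)[of "1 / p"] p
    by (simp add: admissible_iff norm_fun_eq)
  show "norm_fun p \<Phi>' f < \<infinity>"
    using assms norm_int_Phi'_le[of f] epowr_pos_finite(2)[of "1 / p"] p
    by (auto simp: admissible_iff norm_fun_eq intro: le_less_trans)
qed

lemma fun_imp_bilinear:
  assumes "fun_transform_ineq p q \<alpha> \<rho> \<gamma> \<sigma> \<beta> \<delta> \<mu> \<nu> c"
  shows "bilinear_ineq p q \<alpha> \<rho> \<gamma> \<sigma> \<beta> \<delta> \<mu> \<nu> c"
  unfolding bilinear_ineq_def
proof (intro allI impI)
  fix f a assume adm: "admissible p q \<sigma> \<beta> \<delta> \<mu> \<nu> f a"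
  then have "ennreal c * norm_fun p \<Phi>' f < fun_transform_lhs p \<alpha> \<rho> \<gamma> \<sigma> \<beta> \<delta> \<mu> \<nu> f"
    using assms unfolding fun_transform_ineq_def by blast
  then have "ennreal c * norm_fun p \<Phi>' f * norm_seq q \<Psi> a <
      fun_transform_lhs p \<alpha> \<rho> \<gamma> \<sigma> \<beta> \<delta> \<mu> \<nu> f * norm_seq q \<Psi> a"
    using norms_finite_pos[OF adm] by (intro ennreal_mult_strict_right_mono) auto
  also have "\<dots> \<le> bilinear_lhs \<alpha> \<rho> \<gamma> \<beta> \<delta> \<mu> \<nu> f a"
    using adm norm_sum_finite_pos by (intro reverse_Hoelder_seq) (auto simp: admissible_iff)
  finally show "ennreal c * norm_fun p \<Phi>' f * norm_seq q \<Psi> a < bilinear_lhs \<alpha> \<rho> \<gamma> \<beta> \<delta> \<mu> \<nu> f a" .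
qed

lemma seq_imp_bilinear:
  assumes "seq_transform_ineq p q \<alpha> \<rho> \<gamma> \<sigma> \<beta> \<delta> \<mu> \<nu> c"
  shows "bilinear_ineq p q \<alpha> \<rho> \<gamma> \<sigma> \<beta> \<delta> \<mu> \<nu> c"
  unfolding bilinear_ineq_def
proof (intro allI impI)
  fix f a assume adm: "admissible p q \<sigma> \<beta> \<delta> \<mu> \<nu> f a"
  note fin = norms_finite_pos[OF adm]
  have less: "ennreal c * norm_seq q \<Psi> a < seq_transform_lhs q \<alpha> \<rho> \<gamma> \<sigma> \<beta> \<delta> \<mu> \<nu> a"
    using assms adm unfolding seq_transform_ineq_def by blast
  show "ennreal c * norm_fun p \<Phi>' f * norm_seq q \<Psi> a < bilinear_lhs \<alpha> \<rho> \<gamma> \<beta> \<delta> \<mu> \<nu> f a"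
  \<comment> \<open>Reverse Hoelder in \<open>x\<close> requires a finite bilinear form; if it is
    infinite, finiteness of both norms on the right settles the claim.\<close>
  proof (cases "bilinear_lhs \<alpha> \<rho> \<gamma> \<beta> \<delta> \<mu> \<nu> f a < \<infinity>")
    case True
    have "norm_fun p \<Phi>' f * (ennreal c * norm_seq q \<Psi> a) <
        norm_fun p \<Phi>' f * seq_transform_lhs q \<alpha> \<rho> \<gamma> \<sigma> \<beta> \<delta> \<mu> \<nu> a"
      using less fin by (intro ennreal_mult_strict_left_mono) auto
    also have "\<dots> \<le> bilinear_lhs \<alpha> \<rho> \<gamma> \<beta> \<delta> \<mu> \<nu> f a"
      using adm norm_sum_finite_pos norm_int_Phi'_pos(1) less True
      by (intro reverse_Hoelder_fun) (auto simp: admissible_iff zero_less_iff_neq_zero)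
    finally show ?thesis by (simp add: mult_ac)
  next
    case False
    then have "bilinear_lhs \<alpha> \<rho> \<gamma> \<beta> \<delta> \<mu> \<nu> f a = top" by (simp add: not_less top_unique)
    then show ?thesis using fin by (simp add: ennreal_mult_less_top)
  qed
qed

lemma ineq_antimono:
  assumes "c \<le> d"
  shows "bilinear_ineq p q \<alpha> \<rho> \<gamma> \<sigma> \<beta> \<delta> \<mu> \<nu> d \<Longrightarrow> bilinear_ineq p q \<alpha> \<rho> \<gamma> \<sigma> \<beta> \<delta> \<mu> \<nu> c"
    and "fun_transform_ineq p q \<alpha> \<rho> \<gamma> \<sigma> \<beta> \<delta> \<mu> \<nu> d \<Longrightarrow> fun_transform_ineq p q \<alpha> \<rho> \<gamma> \<sigma> \<beta> \<delta> \<mu> \<nu> c"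
    and "seq_transform_ineq p q \<alpha> \<rho> \<gamma> \<sigma> \<beta> \<delta> \<mu> \<nu> d \<Longrightarrow> seq_transform_ineq p q \<alpha> \<rho> \<gamma> \<sigma> \<beta> \<delta> \<mu> \<nu> c"
proof -
  have "ennreal c * x \<le> ennreal d * x" for x
    using assms by (intro mult_right_mono ennreal_leI) auto
  then show "bilinear_ineq p q \<alpha> \<rho> \<gamma> \<sigma> \<beta> \<delta> \<mu> \<nu> d \<Longrightarrow> bilinear_ineq p q \<alpha> \<rho> \<gamma> \<sigma> \<beta> \<delta> \<mu> \<nu> c"
    "fun_transform_ineq p q \<alpha> \<rho> \<gamma> \<sigma> \<beta> \<delta> \<mu> \<nu> d \<Longrightarrow> fun_transform_ineq p q \<alpha> \<rho> \<gamma> \<sigma> \<beta> \<delta> \<mu> \<nu> c"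
    "seq_transform_ineq p q \<alpha> \<rho> \<gamma> \<sigma> \<beta> \<delta> \<mu> \<nu> d \<Longrightarrow> seq_transform_ineq p q \<alpha> \<rho> \<gamma> \<sigma> \<beta> \<delta> \<mu> \<nu> c"
    unfolding bilinear_ineq_def fun_transform_ineq_def seq_transform_ineq_def mult.assoc
    by (blast intro: le_less_trans)+
qed

section \<open>Optimality of the constant\<close>

text \<open>The shift \<open>e / p\<close> turns \<open>\<Phi> f^p\<close> into
  \<open>Y^(e - 1)\<close> times the Jacobian, integrable near \<open>Y = 0\<close>; the cut at
  \<open>r\<close> also removes the divergence for large \<open>Y\<close>.\<close>

definition test_fun :: "real \<Rightarrow> real \<Rightarrow> real \<Rightarrow> real" where
  "test_fun r e x = (if Y x \<le> r then \<mu> x * U \<mu> x powr (\<delta> * (\<sigma> + e / p) - 1) else 0)"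

text \<open>For \<open>n \<ge> 1\<close>, \<open>s (n - 1)\<close> is
  \<open>V \<nu> n - \<beta>\<close>; the value at \<open>n = 0\<close> is never inspected.\<close>

definition test_seq :: "real \<Rightarrow> nat \<Rightarrow> real" where
  "test_seq e n = \<nu> (n + 1) * s (n - 1) powr (\<sigma> - e / q - 1)"

lemma measurable_test_fun [measurable]: "test_fun r e \<in> borel_measurable M"
  unfolding test_fun_def[abs_def] by measurable

lemma test_fun_nonneg: "0 < x \<Longrightarrow> 0 \<le> test_fun r e x"
  using mu_pos[of x] by (simp add: test_fun_def)

lemma test_seq_pos: "0 < test_seq e (Suc n)"
  using nu_pos[of "n + 2"] s_pos[of n] by (simp add: test_seq_def)

lemma Phi_test_fun:
  assumes x: "0 < x"
  shows "ennreal (\<Phi> x) * epowr (ennreal (test_fun r e x)) p =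
    ennreal (if Y x \<le> r then \<mu> x * U \<mu> x powr (\<delta> * e - 1) else 0)"
proof (cases "Y x \<le> r")
  case True
  note pos = mu_pos[OF x] U_pos[OF x] Phi_pos[OF x]
  have t: "0 < test_fun r e x" using True pos by (simp add: test_fun_def)
  have "\<Phi> x * test_fun r e x powr p = \<mu> x * U \<mu> x powr (\<delta> * e - 1)"
  proof (rule ln_eq_imp_eq)
    have "ln (\<Phi> x * test_fun r e x powr p) =
        ((p * (1 - \<delta> * \<sigma>) - 1) * ln (U \<mu> x) + (1 - p) * ln (\<mu> x)) +
        p * (ln (\<mu> x) + (\<delta> * (\<sigma> + e / p) - 1) * ln (U \<mu> x))"
      using pos t True by (simp add: ln_mult ln_powr Phi_eq[OF x] test_fun_def)
    also have "\<dots> = ln (\<mu> x) + (\<delta> * (p * (e / p)) - 1) * ln (U \<mu> x)"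
      by algebra
    also have "\<dots> = ln (\<mu> x * U \<mu> x powr (\<delta> * e - 1))"
      using pos p by (simp add: ln_mult ln_powr)
    finally show "ln (\<Phi> x * test_fun r e x powr p) = ln (\<mu> x * U \<mu> x powr (\<delta> * e - 1))" .
  qed (use pos t in auto)
  then show ?thesis using True t pos by (simp add: epowr_ennreal ennreal_mult[symmetric])
qed (use p in \<open>simp add: test_fun_def epowr_0\<close>)

text \<open>Substituting \<open>u = Y x\<close> leaves the integral of \<open>u powr (e - 1)\<close>
  over \<open>{0<..r}\<close>.\<close>

lemma norm_int_test_fun:
  assumes "0 < r" "0 < e"
  shows "norm_int \<Phi> (test_fun r e) = ennreal (r powr e / e)"
proof -
  define F where "F u = indicator {0<..r} u * u powr (e - 1)" for u :: real
  have hi: "((\<lambda>u. u powr (e - 1)) has_integral (r powr e / e)) {0..r}"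
    using has_integral_powr_from_0[of "e - 1" r] assms by simp
  have "set_integrable lborel {0..r} (\<lambda>u. u powr (e - 1))"
    using hi by (intro set_integrable_lborel_nonneg) (auto simp: has_integral_integrable)
  then have si: "set_integrable lborel {0<..r} (\<lambda>u. u powr (e - 1))"
    by (rule set_integrable_subset) auto
  have eq: "indicator {0<..} u *\<^sub>R F u = indicator {0<..r} u *\<^sub>R (u powr (e - 1))" for u
    by (auto simp: F_def split: split_indicator)
  have F: "set_integrable lborel {0<..} F"
    using si unfolding set_integrable_def eq .
  have "(LINT u:{0<..}|lborel. F u) = (LINT u:{0<..r}|lborel. u powr (e - 1))"
    unfolding set_lebesgue_integral_def eq ..
  also have "\<dots> = integral {0<..r} (\<lambda>u. u powr (e - 1))"
    by (rule set_borel_integral_eq_integral(2)[OF si])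
  also have "\<dots> = integral {0..r} (\<lambda>u. u powr (e - 1))"
  proof (rule integral_subset_negligible)
    have "{0..r} - {0<..r} \<subseteq> {0}" by auto
    then show "negligible ({0..r} - {0<..r})" by (rule negligible_subset[rotated]) simp
  qed auto
  also have "\<dots> = r powr e / e" using hi by (rule integral_unique)
  finally have I: "(LINT u:{0<..}|lborel. F u) = r powr e / e" .
  have "norm_int \<Phi> (test_fun r e) = (\<integral>\<^sup>+x\<in>{0<..}. ennreal (F (Y x) * (U \<mu> x powr (\<delta> - 1) * \<mu> x)) \<partial>lebesgue)"
    unfolding norm_int_def nn_integral_M
  proof (rule nn_integral_M_cong)
    fix x :: real assume x: "0 < x"
    have "Y x powr (e - 1) * U \<mu> x powr (\<delta> - 1) = U \<mu> x powr (\<delta> * e - 1)"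
      by (simp add: powr_powr powr_add[symmetric] algebra_simps)
    then have "F (Y x) * (U \<mu> x powr (\<delta> - 1) * \<mu> x) = (if Y x \<le> r then \<mu> x * U \<mu> x powr (\<delta> * e - 1) else 0)"
      using U_pos[OF x] by (simp add: F_def mult.assoc[symmetric])
    then show "ennreal (\<Phi> x) * epowr (ennreal (test_fun r e x)) p = ennreal (F (Y x) * (U \<mu> x powr (\<delta> - 1) * \<mu> x))"
      by (simp only: Phi_test_fun[OF x])
  qed
  also have "\<dots> = ennreal (r powr e / e)"
    by (subst nn_integral_substitution_Y[OF F]) (simp_all add: I F_def)
  finally show ?thesis .
qed

lemma norm_int_test_fun_lower:
  assumes r: "0 < r" and e: "0 < e" and \<eta>: "\<eta> < 1" "\<And>x. 0 < x \<Longrightarrow> Y x \<le> r \<Longrightarrow> \<theta> x \<le> \<eta>"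
  shows "ennreal ((1 - \<eta>) * (r powr e / e)) \<le> norm_int \<Phi>' (test_fun r e)"
proof -
  have "ennreal ((1 - \<eta>) * (r powr e / e)) = ennreal (1 - \<eta>) * norm_int \<Phi> (test_fun r e)"
    unfolding norm_int_test_fun[OF r e] using \<eta>(1) by (intro ennreal_mult') simp
  also have "\<dots> = (\<integral>\<^sup>+x. ennreal (1 - \<eta>) * (ennreal (\<Phi> x) * epowr (ennreal (test_fun r e x)) p) \<partial>M)"
    unfolding norm_int_def by (rule nn_integral_cmult[symmetric]) measurable
  also have "\<dots> \<le> norm_int \<Phi>' (test_fun r e)"
    unfolding norm_int_def
  proof (intro nn_integral_mono_AE AE_M_I)
    fix x :: real assume x: "0 < x"
    show "ennreal (1 - \<eta>) * (ennreal (\<Phi> x) * epowr (ennreal (test_fun r e x)) p) \<le>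
        ennreal (\<Phi>' x) * epowr (ennreal (test_fun r e x)) p"
    proof (cases "Y x \<le> r")
      case True
      have "ennreal (1 - \<eta>) * ennreal (\<Phi> x) \<le> ennreal (\<Phi>' x)"
        using \<eta>(1) \<eta>(2)[OF x True] Phi_pos[OF x]
        by (simp add: ennreal_mult'[symmetric] Phi_tilde_def ennreal_leI mult_right_mono)
      then show ?thesis by (simp add: mult.assoc[symmetric] mult_right_mono)
    next
      case False
      then show ?thesis using p by (simp add: test_fun_def epowr_0)
    qed
  qed
  finally show ?thesis .
qed

text \<open>Appears twice: as the sum in the norm of \<open>test_seq e\<close>, and, times
  \<open>k (\<sigma> + e / p)\<close>, as a bound for the bilinear form.\<close>

definition power_sum :: "real \<Rightarrow> ennreal" where
  "power_sum e = (\<Sum>n. ennreal (\<nu> (n + 2) * s n powr (- 1 - e)))"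

lemma norm_sum_test_seq: "norm_sum (test_seq e) = power_sum e"
  unfolding norm_sum_def power_sum_def
proof (rule suminf_cong)
  fix n
  note pos = s_pos[of n] nu_pos[of "n + 2"] test_seq_pos[of e n] Psi_pos[of n]
  have "\<Psi> (Suc n) * test_seq e (Suc n) powr q = \<nu> (n + 2) * s n powr (- 1 - e)"
  proof (rule ln_eq_imp_eq)
    have "ln (\<Psi> (Suc n) * test_seq e (Suc n) powr q) =
        ((q * (1 - \<sigma>) - 1) * ln (s n) + (1 - q) * ln (\<nu> (n + 2))) +
        q * (ln (\<nu> (n + 2)) + (\<sigma> - e / q - 1) * ln (s n))"
      using pos by (simp add: ln_mult ln_powr Psi_eq test_seq_def)
    also have "\<dots> = ln (\<nu> (n + 2)) + (- 1 - q * (e / q)) * ln (s n)"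
      by algebra
    also have "\<dots> = ln (\<nu> (n + 2) * s n powr (- 1 - e))"
      using pos q_neg by (simp add: ln_mult ln_powr)
    finally show "ln (\<Psi> (Suc n) * test_seq e (Suc n) powr q) = ln (\<nu> (n + 2) * s n powr (- 1 - e))" .
  qed (use pos in auto)
  then show "ennreal (\<Psi> (Suc n)) * epowr (ennreal (test_seq e (Suc n))) q = ennreal (\<nu> (n + 2) * s n powr (- 1 - e))"
    using pos by (simp add: epowr_ennreal ennreal_mult[symmetric])
qed

text \<open>Apart from its first term, the sum is compared with the integral of
  \<open>u powr (- 1 - e)\<close> from \<open>s 0\<close> on, by telescoping.\<close>

lemma power_sum_bounds:
  assumes e: "0 < e"
  shows "0 < power_sum e" "power_sum e \<le> ennreal (\<nu> 2 * s 0 powr (- 1 - e) + s 0 powr (- e) / e)"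
proof -
  let ?t = "\<lambda>n. \<nu> (n + 2) * s n powr (- 1 - e)"
  have t: "0 < ?t n" for n using nu_pos[of "n + 2"] s_pos[of n] by simp
  have "0 < ennreal (?t 0)" using t[of 0] by simp
  also have "\<dots> \<le> power_sum e"
    unfolding power_sum_def using sum_le_suminf[of "\<lambda>n. ennreal (?t n)" "{0}"] by simp
  finally show "0 < power_sum e" .
  have *: "(\<Sum>n<Suc N. ?t n) \<le> ?t 0 + (s 0 powr (- e) - s N powr (- e)) / e" for N
  proof (induction N)
    case (Suc N)
    \<comment> \<open>The decrease of \<open>\<nu>\<close> replaces the gap that starts at
      \<open>s (Suc N)\<close> by the one that ends there, which makes the term a lower
      rectangle.\<close>
    have "?t (Suc N) \<le> \<nu> (N + 2) * s (Suc N) powr (- 1 - e)"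
      using nu_dec[of "N + 2"] by (intro mult_right_mono) (auto simp: eval_nat_numeral)
    also have "\<dots> = (s (Suc N) - s N) * s (Suc N) powr (- 1 - e)"
      by (simp add: s_Suc)
    also have "\<dots> \<le> (s N powr (- e) - s (Suc N) powr (- e)) / e"
      using strict_monoD[OF s_strict_mono, of N "Suc N"] by (intro powr_difference_bound s_pos e) simp
    finally have "(\<Sum>n<Suc (Suc N). ?t n) \<le>
        ?t 0 + (s 0 powr (- e) - s N powr (- e)) / e + (s N powr (- e) - s (Suc N) powr (- e)) / e"
      using Suc.IH by simp
    also have "\<dots> = ?t 0 + (s 0 powr (- e) - s (Suc N) powr (- e)) / e"
      by (simp add: diff_divide_distrib)
    finally show ?case .
  qed simp
  have "(\<Sum>n<N. ennreal (?t n)) \<le> ennreal (\<nu> 2 * s 0 powr (- 1 - e) + s 0 powr (- e) / e)" for N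
  proof -
    have "(\<Sum>n<N. ?t n) \<le> (\<Sum>n<Suc N. ?t n)" using t[of N] by simp
    also have "\<dots> \<le> ?t 0 + (s 0 powr (- e) - s N powr (- e)) / e" by (rule *)
    also have "\<dots> \<le> ?t 0 + s 0 powr (- e) / e"
      using e by (simp add: divide_right_mono)
    finally show ?thesis using t by (simp add: sum_ennreal less_imp_le ennreal_leI numeral_2_eq_2)
  qed
  then show "power_sum e \<le> ennreal (\<nu> 2 * s 0 powr (- 1 - e) + s 0 powr (- e) / e)"
    unfolding power_sum_def by (intro suminf_le_const summableI) auto
qed

lemma gamma_less: "0 < e \<Longrightarrow> \<gamma> < \<sigma> + e / p"
  using gamma_sigma p divide_pos_pos[of e p] by linarith

lemma test_admissible:
  assumes "0 < r" "0 < e"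
  shows "admissible p q \<sigma> \<beta> \<delta> \<mu> \<nu> (test_fun r e) (test_seq e)"
proof -
  have "0 \<le> test_seq e n" if "n \<ge> 1" for n
    using test_seq_pos[of e "n - 1"] that by simp
  then show ?thesis
    using assms power_sum_bounds[of e] test_fun_nonneg
    by (auto simp: admissible_iff norm_int_test_fun norm_sum_test_seq intro: le_less_trans)
qed

text \<open>Dropping the cut at \<open>r\<close> gives the exact weight integral; by
  \<open>1 / p + 1 / q = 1\<close> the exponents of \<open>s n\<close> then add up to
  \<open>- 1 - e\<close>.\<close>

lemma bilinear_test_le:
  assumes "0 < r" "0 < e"
  shows "bilinear_lhs \<alpha> \<rho> \<gamma> \<beta> \<delta> \<mu> \<nu> (test_fun r e) (test_seq e) \<le> ennreal (k (\<sigma> + e / p)) * power_sum e"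
proof -
  note ge = gamma_less[OF assms(2)]
  have "I (test_fun r e) n \<le> ennreal (k (\<sigma> + e / p) * s n powr (- (\<sigma> + e / p)))" for n
    unfolding I_def weight_integral[OF ge, symmetric]
    by (intro nn_integral_mono_AE AE_M_I ennreal_leI mult_left_mono)
      (auto simp: test_fun_def less_imp_le mu_pos K_pos)
  then have "(\<Sum>n. ennreal (test_seq e (Suc n)) * I (test_fun r e) n) \<le>
      (\<Sum>n. ennreal (test_seq e (Suc n)) * ennreal (k (\<sigma> + e / p) * s n powr (- (\<sigma> + e / p))))"
    by (intro suminf_le mult_left_mono) auto
  also have "\<dots> = (\<Sum>n. ennreal (k (\<sigma> + e / p)) * ennreal (\<nu> (n + 2) * s n powr (- 1 - e)))"
  proof (rule suminf_cong)
    fix n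
    have "(\<sigma> - e / q - 1) + - (\<sigma> + e / p) = - 1 - e * (1 / p + 1 / q)"
      by (simp add: algebra_simps)
    then have ex: "(\<sigma> - e / q - 1) + - (\<sigma> + e / p) = - 1 - e" by (simp add: pq)
    have "test_seq e (Suc n) * (k (\<sigma> + e / p) * s n powr (- (\<sigma> + e / p))) =
        k (\<sigma> + e / p) * (\<nu> (n + 2) * (s n powr (\<sigma> - e / q - 1) * s n powr (- (\<sigma> + e / p))))"
      by (simp add: test_seq_def)
    also have "\<dots> = k (\<sigma> + e / p) * (\<nu> (n + 2) * s n powr (- 1 - e))"
      by (simp only: powr_add[symmetric] ex)
    finally show "ennreal (test_seq e (Suc n)) * ennreal (k (\<sigma> + e / p) * s n powr (- (\<sigma> + e / p))) =
        ennreal (k (\<sigma> + e / p)) * ennreal (\<nu> (n + 2) * s n powr (- 1 - e))"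
      by (simp only: ennreal_mult'[symmetric] less_imp_le[OF test_seq_pos] less_imp_le[OF k_pos[OF ge]])
  qed
  also have "\<dots> = ennreal (k (\<sigma> + e / p)) * power_sum e"
    by (simp add: power_sum_def)
  finally show ?thesis
    using test_seq_pos by (simp add: bilinear_lhs_eq_sum less_imp_le)
qed

text \<open>The ineq at the test pair, arranged so that both sides converge as \<open>e\<close>
  tends to 0 with \<open>r\<close> and \<open>\<eta>\<close> fixed.\<close>

lemma bilinear_constant_estimate:
  assumes ineq: "bilinear_ineq p q \<alpha> \<rho> \<gamma> \<sigma> \<beta> \<delta> \<mu> \<nu> c" and c: "0 < c"
    and r: "0 < r" and e: "0 < e" and \<eta>: "\<eta> < 1" "\<And>x. 0 < x \<Longrightarrow> Y x \<le> r \<Longrightarrow> \<theta> x \<le> \<eta>"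
  shows "c * ((1 - \<eta>) * r powr e) powr (1 / p) \<le>
    k (\<sigma> + e / p) * (e * (\<nu> 2 * s 0 powr (- 1 - e)) + s 0 powr (- e)) powr (1 / p)"
proof -
  define k' where "k' = k (\<sigma> + e / p)"
  define N where "N = (1 - \<eta>) * (r powr e / e)"
  have N: "0 < N" using \<eta>(1) r e by (simp add: N_def)
  have k': "0 < k'" unfolding k'_def by (intro k_pos gamma_less e)
  have "power_sum e < \<infinity>" using power_sum_bounds(2)[OF e] by (auto intro: le_less_trans)
  then obtain S where S: "0 < S" "power_sum e = ennreal S"
    using power_sum_bounds(1)[OF e] by (cases "power_sum e" rule: ennreal_zero_top_cases) auto
  have Nle: "ennreal (N powr (1 / p)) \<le> norm_fun p \<Phi>' (test_fun r e)"
  proof -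
    have "\<not> epowr (norm_int \<Phi>' (test_fun r e)) (1 / p) < epowr (ennreal N) (1 / p)"
      using norm_int_test_fun_lower[OF r e \<eta>] p epowr_less_iff[of "1 / p"] by (simp add: N_def not_less)
    then show ?thesis using N by (simp add: norm_fun_eq epowr_ennreal not_less)
  qed
  have "ennreal (c * N powr (1 / p) * S powr (1 / q)) = ennreal c * ennreal (N powr (1 / p)) * norm_seq q \<Psi> (test_seq e)"
    using c S by (simp add: norm_seq_eq norm_sum_test_seq epowr_ennreal ennreal_mult)
  also have "\<dots> \<le> ennreal c * norm_fun p \<Phi>' (test_fun r e) * norm_seq q \<Psi> (test_seq e)"
    using Nle by (intro mult_right_mono mult_left_mono) auto
  also have "\<dots> \<le> bilinear_lhs \<alpha> \<rho> \<gamma> \<beta> \<delta> \<mu> \<nu> (test_fun r e) (test_seq e)"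
    using ineq test_admissible[OF r e] unfolding bilinear_ineq_def by (blast intro: less_imp_le)
  also have "\<dots> \<le> ennreal (k' * S)"
    using bilinear_test_le[OF r e] S k' by (simp add: k'_def ennreal_mult')
  finally have "c * N powr (1 / p) * S powr (1 / q) \<le> k' * S"
    using k' S by (simp add: ennreal_le_iff)
  \<comment> \<open>Since \<open>1 - 1 / q = 1 / p\<close>, this factor collects \<open>S\<close> on
    the right as \<open>(e * S) powr (1 / p)\<close>, so an upper bound for \<open>S\<close>
    suffices; \<open>e powr (1 / p)\<close> cancels the growth on both sides.\<close>
  then have "c * N powr (1 / p) * S powr (1 / q) * (S powr (- (1 / q)) * e powr (1 / p)) \<le>
      k' * S * (S powr (- (1 / q)) * e powr (1 / p))"
    by (rule mult_right_mono) simp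
  moreover have "c * N powr (1 / p) * S powr (1 / q) * (S powr (- (1 / q)) * e powr (1 / p)) =
      c * ((1 - \<eta>) * r powr e) powr (1 / p)"
  proof -
    have "(1 - \<eta>) * r powr e = N * e" using e by (simp add: N_def)
    moreover have "(N * e) powr (1 / p) = N powr (1 / p) * e powr (1 / p)"
      using N e by (simp add: powr_mult)
    moreover have "S powr (1 / q) * S powr (- (1 / q)) = 1"
      using S by (simp add: powr_minus)
    ultimately show ?thesis by (simp add: mult_ac)
  qed
  moreover have "k' * S * (S powr (- (1 / q)) * e powr (1 / p)) = k' * (e * S) powr (1 / p)"
  proof -
    have "S * S powr (- (1 / q)) = S powr (1 + - (1 / q))"
      using powr_mult_base[of S "- (1 / q)"] S by simp
    also have "1 + - (1 / q) = 1 / p" using pq by linarith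
    finally show ?thesis using S e by (simp add: powr_mult mult_ac)
  qed
  moreover have "(e * S) powr (1 / p) \<le> (e * (\<nu> 2 * s 0 powr (- 1 - e)) + s 0 powr (- e)) powr (1 / p)"
  proof (rule powr_mono2)
    have "S \<le> \<nu> 2 * s 0 powr (- 1 - e) + s 0 powr (- e) / e"
      using power_sum_bounds(2)[OF e] nu_pos[of 2] S e
      by (simp only: S(2)) (subst (asm) ennreal_le_iff, simp_all)
    then have "e * S \<le> e * (\<nu> 2 * s 0 powr (- 1 - e) + s 0 powr (- e) / e)"
      using e by (intro mult_left_mono) auto
    then show "e * S \<le> e * (\<nu> 2 * s 0 powr (- 1 - e)) + s 0 powr (- e)"
      using e by (simp add: distrib_left)
  qed (use p S e in auto)
  ultimately have "c * ((1 - \<eta>) * r powr e) powr (1 / p) \<le> k' * (e * S) powr (1 / p)"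
    by simp
  also have "\<dots> \<le> k' * (e * (\<nu> 2 * s 0 powr (- 1 - e)) + s 0 powr (- e)) powr (1 / p)"
    using k' \<open>(e * S) powr (1 / p) \<le> _\<close> by (intro mult_left_mono) auto
  finally show ?thesis unfolding k'_def .
qed

text \<open>The radius depends on \<open>\<eta>\<close> alone, so it stays fixed while
  \<open>e\<close> tends to 0.\<close>

lemma theta_small:
  assumes "0 < \<eta>"
  obtains r where "0 < r" "\<And>x. 0 < x \<Longrightarrow> Y x \<le> r \<Longrightarrow> \<theta> x \<le> \<eta>"
proof -
  obtain t where t: "0 < t" "(LINT u:{0<..t}|lborel. g \<sigma> u) < \<eta> * k \<sigma>"
    using head_small[OF gamma_sigma, of "\<eta> * k \<sigma>"] assms k_sigma_pos by auto
  show thesis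
  proof (rule that[of "t / s 0"])
    show "0 < t / s 0" using t s_pos by simp
    fix x :: real assume "0 < x" "Y x \<le> t / s 0"
    then have "Y x * s 0 \<le> t" using s_pos[of 0] by (simp add: field_simps)
    then have "(LINT u:{0<..Y x * s 0}|lborel. g \<sigma> u) \<le> (LINT u:{0<..t}|lborel. g \<sigma> u)"
      by (intro g_integral_mono gamma_sigma) auto
    then show "\<theta> x \<le> \<eta>" using t k_sigma_pos by (simp add: theta_eq field_simps)
  qed
qed

text \<open>Two successive limits: \<open>e\<close> tends to 0 for fixed \<open>\<eta>\<close>,
  where \<open>r powr e\<close> and \<open>s 0 powr (- e)\<close> tend to 1; then
  \<open>\<eta>\<close> tends to 0.\<close>

lemma bilinear_constant_le:
  assumes ineq: "bilinear_ineq p q \<alpha> \<rho> \<gamma> \<sigma> \<beta> \<delta> \<mu> \<nu> c" and c: "0 < c"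
  shows "c \<le> k \<sigma>"
proof -
  have lim: "c * (1 - \<eta>) powr (1 / p) \<le> k \<sigma>" if \<eta>: "0 < \<eta>" "\<eta> < 1" for \<eta>
  proof -
    obtain r where r: "0 < r" "\<And>x. 0 < x \<Longrightarrow> Y x \<le> r \<Longrightarrow> \<theta> x \<le> \<eta>"
      using theta_small[OF \<eta>(1)] by blast
    define e where "e n = inverse (real (Suc n))" for n
    have e: "e \<longlonglongrightarrow> 0" unfolding e_def by (rule LIMSEQ_inverse_real_of_nat)
    have e_pos: "0 < e n" and e_le: "e n \<le> 1" for n
      by (simp_all add: e_def inverse_le_1_iff)
    have "(\<lambda>n. e n / p) \<longlonglongrightarrow> 0 / p" by (intro tendsto_divide e tendsto_const) (use p in simp)
    then have "(\<lambda>n. k (\<sigma> + e n / p)) \<longlonglongrightarrow> k \<sigma>"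
      using p e_pos e_le
      by (intro k_tendsto[OF gamma_sigma, where C = "1 / p"]) (auto simp: less_imp_le divide_right_mono)
    moreover have "(\<lambda>n. (e n * (\<nu> 2 * s 0 powr (- 1 - e n)) + s 0 powr (- e n)) powr (1 / p)) \<longlonglongrightarrow>
        (0 * (\<nu> 2 * s 0 powr (- 1 - 0)) + s 0 powr (- 0)) powr (1 / p)"
      by (intro tendsto_intros e) (use s_pos[of 0] in auto)
    ultimately have R: "(\<lambda>n. k (\<sigma> + e n / p) * (e n * (\<nu> 2 * s 0 powr (- 1 - e n)) + s 0 powr (- e n)) powr (1 / p)) \<longlonglongrightarrow>
        k \<sigma> * (0 * (\<nu> 2 * s 0 powr (- 1 - 0)) + s 0 powr (- 0)) powr (1 / p)"
      by (rule tendsto_mult)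
    have L: "(\<lambda>n. c * ((1 - \<eta>) * r powr e n) powr (1 / p)) \<longlonglongrightarrow> c * ((1 - \<eta>) * r powr 0) powr (1 / p)"
      by (intro tendsto_intros e) (use r \<eta> in auto)
    have "c * ((1 - \<eta>) * r powr 0) powr (1 / p) \<le>
        k \<sigma> * (0 * (\<nu> 2 * s 0 powr (- 1 - 0)) + s 0 powr (- 0)) powr (1 / p)"
      by (rule LIMSEQ_le[OF L R])
        (use bilinear_constant_estimate[OF ineq c r(1) e_pos \<eta>(2) r(2)] in blast)
    then show ?thesis using r s_pos[of 0] by simp
  qed
  have "(\<lambda>n. c * (1 - inverse (real (Suc n))) powr (1 / p)) \<longlonglongrightarrow> c * (1 - 0) powr (1 / p)"
    by (intro tendsto_intros LIMSEQ_inverse_real_of_nat) auto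
  \<comment> \<open>The shift by one avoids \<open>\<eta> = 1\<close> at index 0, which
    \<open>lim\<close> excludes.\<close>
  then have "(\<lambda>n. c * (1 - inverse (real (Suc (Suc n)))) powr (1 / p)) \<longlonglongrightarrow> c * (1 - 0) powr (1 / p)"
    by (rule LIMSEQ_Suc)
  then have "c * (1 - 0) powr (1 / p) \<le> k \<sigma>"
  proof (rule LIMSEQ_le_const2)
    have "c * (1 - inverse (real (Suc (Suc n)))) powr (1 / p) \<le> k \<sigma>" for n
      by (rule lim) (auto simp: field_simps)
    then show "\<exists>N. \<forall>n\<ge>N. c * (1 - inverse (real (Suc (Suc n)))) powr (1 / p) \<le> k \<sigma>" by blast
  qed
  then show ?thesis by simp
qed

lemma all_ineqs_hold:
  assumes "c \<le> k \<sigma>"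
  shows "bilinear_ineq p q \<alpha> \<rho> \<gamma> \<sigma> \<beta> \<delta> \<mu> \<nu> c" "fun_transform_ineq p q \<alpha> \<rho> \<gamma> \<sigma> \<beta> \<delta> \<mu> \<nu> c"
    "seq_transform_ineq p q \<alpha> \<rho> \<gamma> \<sigma> \<beta> \<delta> \<mu> \<nu> c"
  using ineq_antimono[OF assms] fun_imp_bilinear fun_transform_ineq_k seq_transform_ineq_k by blast+

lemma all_ineqs_fail:
  assumes "k \<sigma> < c"
  shows "\<not> bilinear_ineq p q \<alpha> \<rho> \<gamma> \<sigma> \<beta> \<delta> \<mu> \<nu> c" "\<not> fun_transform_ineq p q \<alpha> \<rho> \<gamma> \<sigma> \<beta> \<delta> \<mu> \<nu> c"
    "\<not> seq_transform_ineq p q \<alpha> \<rho> \<gamma> \<sigma> \<beta> \<delta> \<mu> \<nu> c"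
proof -
  show "\<not> bilinear_ineq p q \<alpha> \<rho> \<gamma> \<sigma> \<beta> \<delta> \<mu> \<nu> c"
    using bilinear_constant_le[of c] assms k_sigma_pos by auto
  then show "\<not> fun_transform_ineq p q \<alpha> \<rho> \<gamma> \<sigma> \<beta> \<delta> \<mu> \<nu> c" "\<not> seq_transform_ineq p q \<alpha> \<rho> \<gamma> \<sigma> \<beta> \<delta> \<mu> \<nu> c"
    using fun_imp_bilinear seq_imp_bilinear by blast+
qed

end

theorem theorem4p2:
  fixes \<alpha> \<rho> \<gamma> \<sigma> \<beta> \<delta> p q :: real
    and \<mu> :: "real \<Rightarrow> real" and \<nu> :: "nat \<Rightarrow> real"
  assumes nu_pos: "\<forall>n\<ge>1. 0 < \<nu> n"
    and nu_dec: "\<forall>n\<ge>1. \<nu> (n + 1) \<le> \<nu> n"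
    and beta: "\<beta> \<le> \<nu> 1 / 2"
    and mu_pos: "\<forall>x>0. 0 < \<mu> x"
    and mu_cont: "continuous_on {0<..} \<mu>"
    and mu_int: "\<forall>x>0. set_integrable lborel {0<..x} \<mu>"
    and delta: "\<delta> \<in> {-1, 1}"
    and rho: "\<rho> > max 0 (- \<alpha>)"
    and gamma: "0 < \<gamma>" and gamma_sigma: "\<gamma> < \<sigma>" and sigma: "\<sigma> \<le> 1"
    and U_inf: "filterlim (U \<mu>) at_top at_top"
    and V_inf: "filterlim (V \<nu>) at_top sequentially"
    and p: "0 < p" "p < 1"
    and pq: "1 / p + 1 / q = 1"
  shows "(bilinear_ineq p q \<alpha> \<rho> \<gamma> \<sigma> \<beta> \<delta> \<mu> \<nu> (k_const \<alpha> \<rho> \<gamma> \<sigma>) \<and>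
          fun_transform_ineq p q \<alpha> \<rho> \<gamma> \<sigma> \<beta> \<delta> \<mu> \<nu> (k_const \<alpha> \<rho> \<gamma> \<sigma>) \<and>
          seq_transform_ineq p q \<alpha> \<rho> \<gamma> \<sigma> \<beta> \<delta> \<mu> \<nu> (k_const \<alpha> \<rho> \<gamma> \<sigma>)) \<and>
         (\<forall>c>0. (bilinear_ineq p q \<alpha> \<rho> \<gamma> \<sigma> \<beta> \<delta> \<mu> \<nu> c \<longleftrightarrow> fun_transform_ineq p q \<alpha> \<rho> \<gamma> \<sigma> \<beta> \<delta> \<mu> \<nu> c) \<and>
                (bilinear_ineq p q \<alpha> \<rho> \<gamma> \<sigma> \<beta> \<delta> \<mu> \<nu> c \<longleftrightarrow> seq_transform_ineq p q \<alpha> \<rho> \<gamma> \<sigma> \<beta> \<delta> \<mu> \<nu> c)) \<and>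
         (\<forall>c>k_const \<alpha> \<rho> \<gamma> \<sigma>.
            \<not> bilinear_ineq p q \<alpha> \<rho> \<gamma> \<sigma> \<beta> \<delta> \<mu> \<nu> c \<and>
            \<not> fun_transform_ineq p q \<alpha> \<rho> \<gamma> \<sigma> \<beta> \<delta> \<mu> \<nu> c \<and>
            \<not> seq_transform_ineq p q \<alpha> \<rho> \<gamma> \<sigma> \<beta> \<delta> \<mu> \<nu> c)"
proof -
  interpret half_discrete \<alpha> \<rho> \<gamma> \<mu> \<delta> \<sigma> \<beta> p q \<nu>
    by unfold_locales (use assms in auto)
  show ?thesis
    unfolding k_const_eq using all_ineqs_hold all_ineqs_fail by (meson linorder_not_le order_refl)
qed

end
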